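(* Let $E$ be a countable subset of $\mathbb R$ without accumulation points, endowed with the counting measure, satisfying $\sum_{n\in E}\frac1{1+n^2}<\infty$. Let $\Pi$ be a kernel inducing an operator of orthogonal projection on $L_2(E)$, with range $L$. Let $p_1,\dots,p_l\in E$ be distinct points such that there is no nonzero function in $L$ supported on the set $\{p_1,\dots,p_l\}$. Then, for any $m\le l$ and any permutation $\sigma$ of $p_1,\dots,p_l$, the limit $$\overline\Psi(p_1,\dots,p_l,m,\sigma)=\lim_{R\to\infty}\overline\Psi_R(p_1,\dots,p_l,m,\sigma)$$ exists in $L_1(\mathrm{Conf}(E),\mathbb P_{\Pi^{p_1,\dots,p_m,\breve p_{m+1},\dots,\breve p_l}})$.
   Context: $\mathrm{Conf}(E)$ is the space of configurations on $E$ (subsets of $E$). For an orthogonal projection $K$ on $L_2(E)$, $\mathbb P_K$ is the determinantal measure: the unique probability measure on $\mathrm{Conf}(E)$ with $\mathbb E\prod_{x\in X}g(x)=\det(1+(g-1)K\chi_B)$ for every bounded function $g$ with $g-1$ supported in a bounded (hence finite) set $B$. $L(p_1,\dots,p_m,\breve p_{m+1},\dots,\breve p_l)=\{\chi_{E\setminus\{p_{m+1},\dots,p_l\}}\varphi:\varphi\in L,\ \varphi(p_1)=\dots=\varphi(p_m)=0\}$ (a closed subspace under the assumption on $p_1,\dots,p_l$), and $\Pi^{p_1,\dots,p_m,\breve p_{m+1},\dots,\breve p_l}$ is the orthogonal projection onto it. For $R>0$, $$\overline\Psi_R(p_1,\dots,p_l,m,\sigma;X)=C_R\prod_{x\in X,\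 |x|\le R}\ \prod_{i=1}^m\Bigl(\frac{x-\sigma(p_i)}{x-p_i}\Bigr)^2\chi_{E\setminus\{p_1,\dots,p_l\}}(x),$$ where factors with $x\in\{p_1,\dots,p_l\}$ are read as $0$ and the positive constant $C_R$ is chosen so that $\int_{\mathrm{Conf}(E)}\overline\Psi_R(p_1,\dots,p_l,m,\sigma)\,d\mathbb P_{\Pi^{p_1,\dots,p_m,\breve p_{m+1},\dots,\breve p_l}}=1$. *)

theory Defs
  imports "HOL-Probability.Probability" "HOL-Combinatorics.Permutations"
begin

text \<open>
  The space \<open>L\<^sub>2(E)\<close> for the counting measure on \<open>E\<close> is complex; its elements are
  represented by functions on the real line that vanish outside \<open>E\<close>, so that equality of
  elements is equality of functions.
\<close>

definition l2_space :: "real set \<Rightarrow> (real \<Rightarrow> complex) set" where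
  "l2_space E = {f. (\<forall>x. x \<notin> E \<longrightarrow> f x = 0) \<and> (\<lambda>x. (cmod (f x))\<^sup>2) summable_on E}"

definition l2_inner :: "real set \<Rightarrow> (real \<Rightarrow> complex) \<Rightarrow> (real \<Rightarrow> complex) \<Rightarrow> complex" where
  "l2_inner E f g = (\<Sum>\<^sub>\<infinity>x\<in>E. f x * cnj (g x))"

definition kernel_op ::
  "real set \<Rightarrow> (real \<Rightarrow> real \<Rightarrow> complex) \<Rightarrow> (real \<Rightarrow> complex) \<Rightarrow> real \<Rightarrow> complex" where
  "kernel_op E K f = (\<lambda>x. if x \<in> E then (\<Sum>\<^sub>\<infinity>y\<in>E. K x y * f y) else 0)"

text \<open>
  Boundedness is not required separately: an everywhere defined symmetric idempotent
  satisfies \<open>\<parallel>Pf\<parallel>\<^sup>2 = \<langle>Pf, f\<rangle> \<le> \<parallel>Pf\<parallel> \<parallel>f\<parallel>\<close>.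
\<close>

definition orthogonal_projection_kernel ::
  "real set \<Rightarrow> (real \<Rightarrow> real \<Rightarrow> complex) \<Rightarrow> bool" where
  "orthogonal_projection_kernel E K \<longleftrightarrow>
     (\<forall>f\<in>l2_space E. (\<forall>x\<in>E. (\<lambda>y. K x y * f y) summable_on E) \<and> kernel_op E K f \<in> l2_space E) \<and>
     (\<forall>f\<in>l2_space E. kernel_op E K (kernel_op E K f) = kernel_op E K f) \<and>
     (\<forall>f\<in>l2_space E. \<forall>g\<in>l2_space E.
        l2_inner E (kernel_op E K f) g = l2_inner E f (kernel_op E K g))"

definition kernel_range ::
  "real set \<Rightarrow> (real \<Rightarrow> real \<Rightarrow> complex) \<Rightarrow> (real \<Rightarrow> complex) set" where
  "kernel_range E K = kernel_op E K ` l2_space E"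

definition orth_proj ::
  "real set \<Rightarrow> (real \<Rightarrow> complex) set \<Rightarrow> (real \<Rightarrow> complex) \<Rightarrow> real \<Rightarrow> complex" where
  "orth_proj E M f = (THE g. g \<in> M \<and> (\<forall>h\<in>M. l2_inner E (\<lambda>x. f x - g x) h = 0))"

text \<open>The kernel of the orthogonal projection onto \<open>M\<close>: its column at \<open>y\<close> is the image of
  the unit vector at \<open>y\<close>.\<close>

definition proj_kernel ::
  "real set \<Rightarrow> (real \<Rightarrow> complex) set \<Rightarrow> real \<Rightarrow> real \<Rightarrow> complex" where
  "proj_kernel E M = (\<lambda>x y. orth_proj E M (\<lambda>z. if z = y then 1 else 0) x)"

text \<open>The subspace \<open>L(p\<^sub>1, \<dots>, p\<^sub>m, \<breve>p\<^sub>m\<^sub>+\<^sub>1, \<dots>, \<breve>p\<^sub>l)\<close>.\<close>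

definition pinned_subspace ::
  "real set \<Rightarrow> (real \<Rightarrow> complex) set \<Rightarrow> (nat \<Rightarrow> real) \<Rightarrow> nat \<Rightarrow> nat \<Rightarrow> (real \<Rightarrow> complex) set" where
  "pinned_subspace E L p m l =
     {(\<lambda>x. indicator (E - p ` {m+1..l}) x * \<phi> x) | \<phi>. \<phi> \<in> L \<and> (\<forall>i\<in>{1..m}. \<phi> (p i) = 0)}"

text \<open>
  Configurations on \<open>E\<close> are arbitrary subsets of \<open>E\<close>, which are locally finite
  because \<open>E\<close> will have no accumulation points. The sigma-algebra is generated by the
  occupation events of single points.
\<close>

definition Conf :: "real set \<Rightarrow> real set measure" where
  "Conf E = sigma (Pow E) ((\<lambda>x. {X \<in> Pow E. x \<in> X}) ` E)"

text \<open>Leibniz determinant of a matrix indexed by a finite set.\<close>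

definition det_on :: "'i set \<Rightarrow> ('i \<Rightarrow> 'i \<Rightarrow> complex) \<Rightarrow> complex" where
  "det_on B A = (\<Sum>\<tau> | \<tau> permutes B. of_int (sign \<tau>) * (\<Prod>i\<in>B. A i (\<tau> i)))"

text \<open>
  As \<open>g - 1\<close> vanishes on \<open>E - B\<close>, the product of \<open>g\<close> over \<open>X\<close> is a product over
  \<open>X \<inter> B\<close> (the library product over an infinite \<open>X\<close> would be 1), and the determinant
  of \<open>1 + (g - 1) K \<chi>\<^sub>B\<close> is that of its block on \<open>B\<close>. For \<open>E\<close> without accumulation
  points, the bounded subsets of \<open>E\<close> are the finite ones.
\<close>

definition determinantal_measure ::
  "real set \<Rightarrow> (real \<Rightarrow> real \<Rightarrow> complex) \<Rightarrow> real set measure \<Rightarrow> bool" where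
  "determinantal_measure E K P \<longleftrightarrow>
     prob_space P \<and> space P = Pow E \<and> sets P = sets (Conf E) \<and>
     (\<forall>B (g :: real \<Rightarrow> complex). finite B \<and> B \<subseteq> E \<and> bounded (g ` E) \<and> (\<forall>x\<in>E - B. g x = 1) \<longrightarrow>
        (\<integral>X. (\<Prod>x\<in>X \<inter> B. g x) \<partial>P) =
        det_on B (\<lambda>x y. (if x = y then 1 else 0) + (g x - 1) * K x y))"

text \<open>The functional before normalization; the indicator makes the factors at the
  points \<open>p\<^sub>1, \<dots>, p\<^sub>l\<close>, where the quotient may be singular, equal to 0.\<close>

definition Psi_unnormalized ::
  "real set \<Rightarrow> (nat \<Rightarrow> real) \<Rightarrow> nat \<Rightarrow> nat \<Rightarrow> (real \<Rightarrow> real) \<Rightarrow> real \<Rightarrow> real set \<Rightarrow> real" where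
  "Psi_unnormalized E p l m \<sigma> R X =
     (\<Prod>x | x \<in> X \<and> \<bar>x\<bar> \<le> R.
        (\<Prod>i=1..m. ((x - \<sigma> (p i)) / (x - p i))\<^sup>2) * indicator (E - p ` {1..l}) x)"

definition Psi_const ::
  "real set \<Rightarrow> real set measure \<Rightarrow> (nat \<Rightarrow> real) \<Rightarrow> nat \<Rightarrow> nat \<Rightarrow> (real \<Rightarrow> real) \<Rightarrow> real \<Rightarrow> real" where
  "Psi_const E P p l m \<sigma> R =
     (THE c. c > 0 \<and> (\<integral>X. c * Psi_unnormalized E p l m \<sigma> R X \<partial>P) = 1)"

definition Psi ::
  "real set \<Rightarrow> real set measure \<Rightarrow> (nat \<Rightarrow> real) \<Rightarrow> nat \<Rightarrow> nat \<Rightarrow> (real \<Rightarrow> real) \<Rightarrow> real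
     \<Rightarrow> real set \<Rightarrow> real" where
  "Psi E P p l m \<sigma> R X = Psi_const E P p l m \<sigma> R * Psi_unnormalized E p l m \<sigma> R X"

end

theory Submission imports Defs begin

text \<open>
  Away from the distinguished points the weight
  \<open>g x = (\<Prod>i=1..m. ((x - \<sigma> (p i)) / (x - p i))\<^sup>2)\<close> is positive and equals \<open>1 + O(1 / \<bar>x\<bar>)\<close>, so
  \<open>g - 1\<close> is square summable over \<open>E\<close> but in general not summable. The products over
  \<open>\<bar>x\<bar> \<le> R\<close> may therefore diverge; what diverges, however, is only the mean of their
  logarithm, which the normalization removes, and the fluctuations are governed by
  \<open>\<Sum>(g - 1)\<^sup>2\<close>.

  To make this precise, let \<open>\<nu>\<close> be the measure reweighted by the normalized product over
  \<open>\<bar>x\<bar> \<le> R\<close>, and let \<open>Y\<close> be the product over the shell \<open>R < \<bar>x\<bar> \<le> T\<close>. The distance in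
  \<open>L\<^sub>1\<close> between the normalized products at \<open>R\<close> and \<open>T\<close> is the \<open>\<nu>\<close>-mean of
  \<open>\<bar>Y / \<integral>Y d\<nu> - 1\<bar>\<close>, which is at most the root of \<open>\<integral>Y\<^sup>2 d\<nu> / (\<integral>Y d\<nu>)\<^sup>2 - 1\<close>. The claim
  \<open>tilted_variance_le\<close> is that this quotient is at most \<open>exp (8 * \<Sum>(g - 1)\<^sup>2)\<close>, the sum being
  over the shell. So the normalized products are Cauchy, and \<open>L\<^sub>1\<close> is complete.

  The bound on the quotient compares both integrals with their first order terms. Let \<open>q x\<close>
  be the \<open>\<nu>\<close>-probability that \<open>x\<close> is occupied. Jensen's inequality gives
  \<open>\<integral>Y d\<nu> \<ge> exp (\<Sum>q x * ln (g x))\<close> for every random set. An upper bound of the same shape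
  expresses the repulsion of determinantal processes. It comes from
  \<open>det_on_tilt_log_submodular\<close>: for a Hermitian kernel, the expected product of a weight \<open>h\<close>
  over \<open>X \<inter> F\<close> is log-submodular as points at which \<open>h - 1\<close> has one sign are added to \<open>F\<close>,
  whatever the weights of the points already in \<open>F\<close>. Keeping the ball in \<open>F\<close> gives the bound
  for \<open>\<nu>\<close>. For weights on both sides of 1 the arithmetic-geometric mean inequality combines the two
  signs, at the cost of second order terms only.

  It remains to see that the kernel of the measure is Hermitian, which amounts to the
  existence of the orthogonal projection onto the pinned subspace. Both operations producing
  that subspace from the range of the given projection, imposing a zero at a point and
  erasing the value at a point, change the projection by a correction along the single vector
  \<open>e\<close> that represents evaluation at the point; so the projection can be written down.
\<close>

section \<open>Determinants of tilted kernels\<close>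

lemma det_on_cong:
  assumes "\<And>i j. i \<in> B \<Longrightarrow> j \<in> B \<Longrightarrow> A i j = A' i j"
  shows "det_on B A = det_on B A'"
  unfolding det_on_def
  by (intro sum.cong arg_cong2[of _ _ _ _ "(*)"] prod.cong)
     (auto simp: assms permutes_in_image)

lemma det_on_empty [simp]: "det_on {} A = 1"
  by (simp add: det_on_def)

text \<open>
  Composition with the transposition of \<open>k\<close> and \<open>l\<close> keeps each product in the Leibniz
  formula and reverses its sign, so the determinant is its own negative.
\<close>

lemma det_on_identical_rows:
  assumes "finite B" "k \<in> B" "l \<in> B" "k \<noteq> l" "A k = A l"
  shows "det_on B A = 0"
proof -
  let ?t = "Transposition.transpose k l"
  let ?S = "{\<tau>. \<tau> permutes B}"
  have t: "?t permutes B"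
    using assms by (intro permutes_swap_id)
  have At: "A (?t i) = A i" for i
    using assms(5) by (simp add: Transposition.transpose_def)
  have prod_eq: "(\<Prod>i\<in>B. A i ((\<tau> \<circ> ?t) i)) = (\<Prod>i\<in>B. A i (\<tau> i))" for \<tau>
  proof -
    have "(\<Prod>i\<in>B. A i (\<tau> i)) = (\<Prod>i\<in>B. A (?t i) (\<tau> (?t i)))"
      using permutes_imp_bij[OF t] by (rule prod.reindex_bij_betw[symmetric])
    then show ?thesis by (simp add: At)
  qed
  have sgn: "sign (\<tau> \<circ> ?t) = - sign \<tau>" if "\<tau> permutes B" for \<tau>
    using that assms t
    by (subst sign_compose) (auto simp: permutation_permutes sign_swap_id)
  have bij: "bij_betw (\<lambda>\<tau>. \<tau> \<circ> ?t) ?S ?S"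
    by (rule bij_betwI[where g="\<lambda>\<tau>. \<tau> \<circ> ?t"])
       (auto simp: o_assoc[symmetric] intro: permutes_compose[OF t])
  have "det_on B A = (\<Sum>\<tau>\<in>?S. of_int (sign (\<tau> \<circ> ?t)) * (\<Prod>i\<in>B. A i ((\<tau> \<circ> ?t) i)))"
    unfolding det_on_def using bij by (rule sum.reindex_bij_betw[symmetric])
  also have "\<dots> = (\<Sum>\<tau>\<in>?S. - (of_int (sign \<tau>) * (\<Prod>i\<in>B. A i (\<tau> i))))"
    unfolding prod_eq by (intro sum.cong) (simp_all add: sgn)
  also have "\<dots> = - det_on B A"
    by (simp add: det_on_def sum_negf)
  finally show ?thesis by simp
qed

lemma det_on_add_row:
  assumes "finite B" "k \<in> B" "l \<in> B" "k \<noteq> l"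
  shows "det_on B (A(k := \<lambda>j. A k j + c * A l j)) = det_on B A"
proof -
  let ?P = "\<lambda>M \<tau>. \<Prod>i\<in>B. M i (\<tau> i)"
  have split: "?P M \<tau> = M k (\<tau> k) * (\<Prod>i\<in>B-{k}. M i (\<tau> i))" for M \<tau>
    using assms by (intro prod.remove)
  have "?P (A(k := \<lambda>j. A k j + c * A l j)) \<tau> = ?P A \<tau> + c * ?P (A(k := A l)) \<tau>" for \<tau>
    unfolding split by (simp add: algebra_simps)
  then have "det_on B (A(k := \<lambda>j. A k j + c * A l j)) = det_on B A + c * det_on B (A(k := A l))"
    by (simp add: det_on_def algebra_simps sum.distrib sum_distrib_left)
  moreover have "det_on B (A(k := A l)) = 0"
    using assms by (intro det_on_identical_rows[of _ k l]) auto
  ultimately show ?thesis by simp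
qed

text \<open>
  A permutation moving \<open>x\<close> sends some element of \<open>F\<close> to \<open>x\<close> and picks up a zero of that
  column.
\<close>

lemma det_on_pivot_column:
  assumes "finite F" "x \<notin> F" "\<And>i. i \<in> F \<Longrightarrow> A i x = 0"
  shows "det_on (insert x F) A = A x x * det_on F A"
proof -
  let ?f = "\<lambda>\<tau>. of_int (sign \<tau>) * (\<Prod>i\<in>insert x F. A i (\<tau> i))"
  have zero: "?f \<tau> = 0" if "\<tau> permutes insert x F" "\<not> \<tau> permutes F" for \<tau>
  proof -
    have "\<tau> x \<noteq> x"
      using that permutes_superset[of \<tau> "insert x F" F] by auto
    have "x \<in> \<tau> ` insert x F"
      unfolding permutes_image[OF that(1)] by simp
    then obtain i where i: "i \<in> insert x F" "\<tau> i = x"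
      by blast
    with \<open>\<tau> x \<noteq> x\<close> assms show ?thesis
      by (auto intro!: prod_zero)
  qed
  have "det_on (insert x F) A = (\<Sum>\<tau> | \<tau> permutes F. ?f \<tau>)"
    unfolding det_on_def
    by (rule sum.mono_neutral_right)
       (use assms zero permutes_subset[of _ F "insert x F"] in \<open>auto simp: finite_permutations\<close>)
  also have "\<dots> = (\<Sum>\<tau> | \<tau> permutes F. A x x * (of_int (sign \<tau>) * (\<Prod>i\<in>F. A i (\<tau> i))))"
    using assms by (intro sum.cong) (auto simp: permutes_not_in)
  finally show ?thesis
    by (simp add: det_on_def sum_distrib_left)
qed

text \<open>
  Gaussian elimination with pivot \<open>A x x\<close>. Removing one index at a time, this reduces
  determinants on large sets to the two-point case.
\<close>

lemma det_on_schur_complement: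
  assumes "finite F" "x \<notin> F" "A x x \<noteq> 0"
  shows "det_on (insert x F) A = A x x * det_on F (\<lambda>i j. A i j - A i x * A x j / A x x)"
proof -
  \<comment> \<open>\<open>M G\<close> is the matrix after the rows in \<open>G\<close> have been cleared in column \<open>x\<close>.\<close>
  define M where "M G = (\<lambda>i j. if i \<in> G then A i j - A i x / A x x * A x j else A i j)" for G
  have "det_on (insert x F) (M G) = det_on (insert x F) A" if "finite G" "G \<subseteq> F" for G
    using that
  proof (induction G rule: finite_induct)
    case empty
    then show ?case by (simp add: M_def)
  next
    case (insert k G)
    have "x \<notin> G" "k \<noteq> x"
      using insert assms by auto
    then have "M (insert k G) = (M G)(k := \<lambda>j. M G k j + (- A k x / A x x) * M G x j)"
      using insert by (auto simp: M_def fun_eq_iff)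
    then show ?case
      using insert assms \<open>k \<noteq> x\<close> by (simp only:) (subst det_on_add_row, auto)
  qed
  from this[of F] have "det_on (insert x F) A = det_on (insert x F) (M F)"
    using assms by simp
  also have "\<dots> = M F x x * det_on F (M F)"
    using assms by (intro det_on_pivot_column) (auto simp: M_def)
  also have "M F x x = A x x"
    using assms by (simp add: M_def)
  also have "det_on F (M F) = det_on F (\<lambda>i j. A i j - A i x * A x j / A x x)"
    by (intro det_on_cong) (simp add: M_def)
  finally show ?thesis .
qed

text \<open>
  The matrix \<open>1 + H K\<close>. With \<open>H = h - 1\<close>, its determinant on \<open>F\<close> is the mean of the product of
  \<open>h\<close> over \<open>X \<inter> F\<close> for the determinantal measure with kernel \<open>K\<close>.
\<close>

definition tilt_matrix :: "('i \<Rightarrow> real) \<Rightarrow> ('i \<Rightarrow> 'i \<Rightarrow> complex) \<Rightarrow> 'i \<Rightarrow> 'i \<Rightarrow> complex" where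
  "tilt_matrix H K = (\<lambda>i j. (if i = j then 1 else 0) + of_real (H i) * K i j)"

lemma det_on_tilt_singleton: "det_on {x} (tilt_matrix H K) = 1 + of_real (H x) * K x x"
  using det_on_pivot_column[of "{}" x] by (simp add: tilt_matrix_def)

text \<open>
  The Schur complement of a tilt matrix is again a tilt matrix with the same \<open>H\<close>. The new
  kernel differs from \<open>K\<close> by a rank one term and is Hermitian if \<open>K\<close> is and \<open>a\<close> is real, which
  makes inductions over the eliminated points possible.
\<close>

lemma det_on_tilt_eliminate:
  fixes K :: "'i \<Rightarrow> 'i \<Rightarrow> complex"
  assumes "finite F" "x \<notin> F" and a: "a = 1 + of_real (H x) * K x x" "a \<noteq> 0"
  shows "det_on (insert x F) (tilt_matrix H K) =
           a * det_on F (tilt_matrix H (\<lambda>i j. K i j - of_real (H x) * K i x * K x j / a))"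
proof -
  have "tilt_matrix H K x x = a"
    by (simp add: tilt_matrix_def a)
  then have "det_on (insert x F) (tilt_matrix H K) = a * det_on F (\<lambda>i j. tilt_matrix H K i j -
       tilt_matrix H K i x * tilt_matrix H K x j / a)"
    using det_on_schur_complement[of F x "tilt_matrix H K"] assms by simp
  also have "det_on F (\<lambda>i j. tilt_matrix H K i j -
       tilt_matrix H K i x * tilt_matrix H K x j / a) =
     det_on F (tilt_matrix H (\<lambda>i j. K i j - of_real (H x) * K i x * K x j / a))"
    using assms by (intro det_on_cong) (auto simp: tilt_matrix_def algebra_simps)
  finally show ?thesis .
qed

text \<open>
  Eliminating the points of \<open>C\<close> multiplies all four determinants by the same positive factor
  and leads to the case \<open>C = {}\<close>. There the claim is the identity
  \<open>d {x} * d {y} - d {x, y} = H x * H y * (cmod (K x y))\<^sup>2\<close>, valid for a Hermitian kernel.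
  Positivity of \<open>d\<close> on all subsets provides the pivots.
\<close>

lemma det_on_tilt_log_submodular:
  fixes K :: "'i \<Rightarrow> 'i \<Rightarrow> complex" and H :: "'i \<Rightarrow> real"
  assumes "finite C" "x \<notin> C" "y \<notin> C" "x \<noteq> y" and sgn: "H x * H y \<ge> 0"
    and "\<And>i j. i \<in> insert x (insert y C) \<Longrightarrow> j \<in> insert x (insert y C) \<Longrightarrow> K j i = cnj (K i j)"
    and "\<And>F. F \<subseteq> insert x (insert y C) \<Longrightarrow> det_on F (tilt_matrix H K) = of_real (d F)"
    and "\<And>F. F \<subseteq> insert x (insert y C) \<Longrightarrow> d F > 0"
  shows "d C * d (insert x (insert y C)) \<le> d (insert x C) * d (insert y C)"
  using assms(1-4,6-)
proof (induction C arbitrary: K d rule: finite_induct)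
  case empty
  let ?a = "1 + of_real (H x) * K x x"
  have d0: "d {} = 1"
    using empty.prems(5)[of "{}"] by simp
  have dx: "of_real (d {x}) = ?a" and dy: "of_real (d {y}) = 1 + of_real (H y) * K y y"
    using empty.prems(5)[of "{x}"] empty.prems(5)[of "{y}"] by (auto simp: det_on_tilt_singleton)
  have "d {x} \<noteq> 0"
    using empty.prems(6)[of "{x}"] by simp
  then have a0: "?a \<noteq> 0"
    unfolding dx[symmetric] by simp
  have cnj: "K y x = cnj (K x y)"
    by (rule empty.prems(4)) simp_all
  have "complex_of_real (d {x, y}) = ?a * (1 + of_real (H y) *
           (K y y - of_real (H x) * K y x * K x y / ?a))"
    using empty.prems(5)[of "{x, y}"] det_on_tilt_eliminate[of "{y}" x ?a H K, OF _ _ refl a0] \<open>x \<noteq> y\<close>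
    by (simp add: det_on_tilt_singleton)
  also have "\<dots> = ?a * (1 + of_real (H y) * K y y) - of_real (H x * H y) * (K x y * cnj (K x y))"
    using a0 by (simp add: field_simps cnj)
  also have "\<dots> = of_real (d {x} * d {y} - H x * H y * (cmod (K x y))\<^sup>2)"
    by (simp only: dx[symmetric] dy[symmetric] complex_norm_square[symmetric] of_real_mult of_real_diff)
  finally have "d {x, y} = d {x} * d {y} - H x * H y * (cmod (K x y))\<^sup>2"
    by (simp only: of_real_eq_iff)
  then show ?case
    using sgn by (simp add: d0)
next
  case (insert z C)
  let ?U = "insert x (insert y C)"
  define a where "a = 1 + of_real (H z) * K z z"
  define K' where "K' = (\<lambda>i j. K i j - of_real (H z) * K i z * K z j / a)"
  define d' where "d' F = d (insert z F) / d {z}" for F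
  have az: "a = of_real (d {z})"
    using insert.prems(5)[of "{z}"] by (simp add: det_on_tilt_singleton a_def)
  have dz: "d {z} > 0"
    using insert.prems(6)[of "{z}"] by auto
  have zU: "z \<notin> ?U"
    using insert by auto
  have det': "det_on F (tilt_matrix H K') = of_real (d' F)" if F: "F \<subseteq> ?U" for F
  proof -
    have fin: "finite F"
      using F insert.hyps(1) by (auto intro: finite_subset)
    have sub: "insert z F \<subseteq> insert x (insert y (insert z C))" and "z \<notin> F"
      using F zU by auto
    have "of_real (d (insert z F)) = det_on (insert z F) (tilt_matrix H K)"
      using insert.prems(5)[OF sub] by simp
    also have "\<dots> = a * det_on F (tilt_matrix H K')"
      unfolding K'_def using dz az by (intro det_on_tilt_eliminate fin \<open>z \<notin> F\<close> a_def) simp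
    finally have "of_real (d (insert z F)) = a * det_on F (tilt_matrix H K')" .
    then show ?thesis
      using dz by (simp add: az d'_def)
  qed
  have "d' C * d' ?U \<le> d' (insert x C) * d' (insert y C)"
  proof (rule insert.IH)
    show "x \<notin> C" "y \<notin> C" "x \<noteq> y"
      using insert.prems by auto
    fix i j assume "i \<in> ?U" "j \<in> ?U"
    then have "K j i = cnj (K i j)" "K j z = cnj (K z j)" "K z i = cnj (K i z)"
      using insert.prems(4) by blast+
    then show "K' j i = cnj (K' i j)"
      by (simp add: K'_def az)
  next
    fix F assume F: "F \<subseteq> ?U"
    then show "det_on F (tilt_matrix H K') = of_real (d' F)"
      by (rule det')
    have "d (insert z F) > 0"
      using F by (intro insert.prems(6)) auto
    then show "d' F > 0"
      using dz by (simp add: d'_def)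
  qed
  then show ?case
    using dz by (simp add: d'_def field_simps insert_commute)
qed

section \<open>Products of a weight over a configuration\<close>

definition mult_func :: "('i \<Rightarrow> real) \<Rightarrow> 'i set \<Rightarrow> 'i set \<Rightarrow> real" where
  "mult_func h F X = (\<Prod>x\<in>X \<inter> F. h x)"

lemma mult_func_alt:
  "finite F \<Longrightarrow> mult_func h F X = (\<Prod>x\<in>F. if x \<in> X then h x else 1)"
  unfolding mult_func_def by (subst Int_commute) (simp add: prod.inter_restrict)

lemma mult_func_cong: "(\<And>x. x \<in> F \<Longrightarrow> h x = k x) \<Longrightarrow> mult_func h F X = mult_func k F X"
  by (simp add: mult_func_def)

lemma mult_func_Un:
  "finite F \<Longrightarrow> finite G \<Longrightarrow> F \<inter> G = {} \<Longrightarrow>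
     mult_func h (F \<union> G) X = mult_func h F X * mult_func h G X"
  by (simp add: mult_func_alt prod.union_disjoint)

lemma mult_func_power: "mult_func (\<lambda>x. h x ^ n) F = (\<lambda>X. mult_func h F X ^ n)"
  by (simp add: mult_func_def[abs_def] prod_power_distrib)

lemma mult_func_pos: "(\<And>x. x \<in> F \<Longrightarrow> h x > 0) \<Longrightarrow> mult_func h F X > 0"
  by (auto simp: mult_func_def intro: prod_pos)

lemma mult_func_insert:
  "finite F \<Longrightarrow> x \<notin> F \<Longrightarrow>
     mult_func h (insert x F) X = mult_func h F X * (1 + (h x - 1) * indicator {Y. x \<in> Y} X)"
  by (auto simp: mult_func_alt)

lemma mult_func_eq_exp:
  assumes "finite F" "\<And>x. x \<in> F \<Longrightarrow> h x > 0"
  shows "mult_func h F X = exp (\<Sum>x\<in>F. ln (h x) * indicator {Y. x \<in> Y} X)"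
  unfolding mult_func_alt[OF assms(1)] exp_sum[OF assms(1)]
  using assms(2) by (intro prod.cong) (simp_all add: indicator_def)

lemma abs_mult_func_le:
  assumes "finite F"
  shows "\<bar>mult_func h F X\<bar> \<le> (\<Prod>x\<in>F. max 1 \<bar>h x\<bar>)"
  using assms by (auto simp: mult_func_alt abs_prod intro!: prod_mono)

text \<open>
  Per occupied point, \<open>(g ^ 4 - 1) / 2\<close> will bound the logarithm of a second moment from above
  and \<open>ln g\<close> the logarithm of a mean from below. The two terms of the difference agree to first order at \<open>g = 1\<close>, so only a quadratic
  error is left.
\<close>

lemma log_ratio_bound:
  fixes g :: real
  assumes "\<bar>g - 1\<bar> \<le> 1/2"
  shows "(g ^ 4 - 1) / 2 - 2 * ln g \<le> 8 * (g - 1)\<^sup>2"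
proof -
  have g: "1/2 \<le> g" "g \<le> 3/2" "g > 0"
    using assms by linarith+
  have "- ln g \<le> 1 / g - 1"
    using ln_le_minus_one[of "1 / g"] g by (simp add: ln_div)
  then have "(g ^ 4 - 1) / 2 - 2 * ln g \<le> (g ^ 4 - 1) / 2 + 2 * (1 / g - 1)"
    by simp
  \<comment> \<open>The double root at 1 splits off; on \<open>[1/2, 3/2]\<close> the chord bound \<open>g * g \<le> 2 * g - 3/4\<close>
    puts the cubic cofactor below \<open>16 * g\<close>, whence the constant 8.\<close>
  also have "\<dots> = (g - 1)\<^sup>2 * (g ^ 3 + 2 * g\<^sup>2 + 3 * g + 4) / (2 * g)"
    using g by (simp add: field_simps power2_eq_square power3_eq_cube power4_eq_xxxx)
  also have "\<dots> \<le> (g - 1)\<^sup>2 * (16 * g) / (2 * g)"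
  proof (intro divide_right_mono mult_left_mono)
    have "g * g \<le> 2 * g - 3/4"
      using mult_nonneg_nonneg[of "g - 1/2" "3/2 - g"] g by (simp add: field_simps)
    moreover from this have "g * (g * g) \<le> g * (2 * g - 3/4)"
      using g by (intro mult_left_mono) auto
    ultimately show "g ^ 3 + 2 * g\<^sup>2 + 3 * g + 4 \<le> 16 * g"
      using g unfolding power3_eq_cube power2_eq_square by (simp add: algebra_simps)
  qed (use g in auto)
  also have "\<dots> = 8 * (g - 1)\<^sup>2"
    using g by simp
  finally show ?thesis .
qed

section \<open>Log-submodularity for Hermitian determinantal measures\<close>

locale hermitian_determinantal =
  fixes E :: "real set" and K :: "real \<Rightarrow> real \<Rightarrow> complex" and P :: "real set measure"
  assumes det: "determinantal_measure E K P"
    and hermitian: "\<And>x y. x \<in> E \<Longrightarrow> y \<in> E \<Longrightarrow> K y x = cnj (K x y)"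

sublocale hermitian_determinantal \<subseteq> prob_space P
  using det by (simp add: determinantal_measure_def)

context hermitian_determinantal
begin

lemma space_P: "space P = Pow E" and sets_P: "sets P = sets (Conf E)"
  using det by (auto simp: determinantal_measure_def)

lemma pred_occupied [measurable]: "x \<in> E \<Longrightarrow> Measurable.pred P (\<lambda>X. x \<in> X)"
  unfolding pred_def space_P sets_P Conf_def
  by (subst sets_measure_of) (auto intro: sigma_sets.Basic)

lemma mult_func_measurable:
  assumes "finite F" "F \<subseteq> E"
  shows "mult_func h F \<in> borel_measurable P"
proof -
  have "(\<lambda>X. \<Prod>x\<in>F. if x \<in> X then h x else 1) \<in> borel_measurable P"
    using assms by (intro borel_measurable_prod measurable_If) auto
  then show ?thesis
    unfolding mult_func_alt[OF assms(1), abs_def] .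
qed

definition norm_const :: "(real \<Rightarrow> real) \<Rightarrow> real set \<Rightarrow> real" where
  "norm_const h F = (\<integral>X. mult_func h F X \<partial>P)"

lemma integrable_mult_func:
  assumes "finite F" "F \<subseteq> E"
  shows "integrable P (mult_func h F)"
  using assms by (intro integrable_const_bound[where B = "\<Prod>x\<in>F. max 1 \<bar>h x\<bar>"])
    (auto intro: mult_func_measurable abs_mult_func_le)

text \<open>
  Since these constants are the determinants of the tilt matrices, their positivity as
  integrals of positive functions provides the pivots for the elimination of points.
\<close>

lemma norm_const_pos:
  assumes "finite F" "F \<subseteq> E" "\<And>x. x \<in> F \<Longrightarrow> h x > 0"
  shows "norm_const h F > 0"
proof -
  have "norm_const h F \<ge> 0"
    unfolding norm_const_def
    by (intro Bochner_Integration.integral_nonneg less_imp_le[OF mult_func_pos] assms(3))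
  moreover have "norm_const h F \<noteq> 0"
  proof
    assume "norm_const h F = 0"
    then have "AE X in P. mult_func h F X = 0"
      unfolding norm_const_def using assms
      by (subst (asm) integral_nonneg_eq_0_iff_AE)
         (auto intro: integrable_mult_func less_imp_le[OF mult_func_pos])
    moreover have "mult_func h F X \<noteq> 0" for X
      using mult_func_pos[of F h X] assms(3) by auto
    ultimately show False
      using AE_False by simp
  qed
  ultimately show ?thesis by simp
qed

lemma norm_const_eq_det:
  assumes "finite F" "F \<subseteq> E"
  shows "det_on F (tilt_matrix (\<lambda>x. h x - 1) K) = of_real (norm_const h F)"
proof -
  \<comment> \<open>The test functions of the definition have to be 1 outside the finite set.\<close>
  define g :: "real \<Rightarrow> complex" where "g x = (if x \<in> F then of_real (h x) else 1)" for x
  have "g ` E \<subseteq> insert 1 (g ` F)"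
    by (auto simp: g_def)
  then have "bounded (g ` E)"
    using assms by (meson bounded_subset finite_imp_bounded finite_imageI finite_insert)
  then have "finite F \<and> F \<subseteq> E \<and> bounded (g ` E) \<and> (\<forall>x\<in>E - F. g x = 1)"
    using assms by (simp add: g_def)
  then have "(\<integral>X. (\<Prod>x\<in>X \<inter> F. g x) \<partial>P) =
      det_on F (\<lambda>x y. (if x = y then 1 else 0) + (g x - 1) * K x y)"
    using det unfolding determinantal_measure_def by blast
  also have "\<dots> = det_on F (tilt_matrix (\<lambda>x. h x - 1) K)"
    by (intro det_on_cong) (simp add: tilt_matrix_def g_def)
  also have "(\<lambda>X. \<Prod>x\<in>X \<inter> F. g x) = (\<lambda>X. of_real (mult_func h F X))"
    by (auto simp: mult_func_def g_def)
  finally show ?thesis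
    by (simp add: norm_const_def)
qed

lemma norm_const_cong: "(\<And>x. x \<in> F \<Longrightarrow> h x = k x) \<Longrightarrow> norm_const h F = norm_const k F"
  unfolding norm_const_def by (intro Bochner_Integration.integral_cong refl mult_func_cong)

lemma norm_const_log_submodular:
  assumes "finite C" "insert x (insert y C) \<subseteq> E" "x \<notin> C" "y \<notin> C" "x \<noteq> y"
    and "\<And>z. z \<in> insert x (insert y C) \<Longrightarrow> h z > 0" and "(h x - 1) * (h y - 1) \<ge> 0"
  shows "norm_const h C * norm_const h (insert x (insert y C))
           \<le> norm_const h (insert x C) * norm_const h (insert y C)"
proof (rule det_on_tilt_log_submodular[where K = K and H = "\<lambda>x. h x - 1"])
  fix F assume F: "F \<subseteq> insert x (insert y C)"
  then have fin: "finite F" "F \<subseteq> E"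
    using assms(1,2) by (auto intro: finite_subset)
  show "det_on F (tilt_matrix (\<lambda>x. h x - 1) K) = of_real (norm_const h F)"
    by (rule norm_const_eq_det[OF fin])
  show "norm_const h F > 0"
    using F assms(6) by (intro norm_const_pos fin) auto
next
  fix i j assume "i \<in> insert x (insert y C)" "j \<in> insert x (insert y C)"
  then show "K j i = cnj (K i j)"
    using assms(2) by (intro hermitian) auto
qed (use assms in auto)

text \<open>
  Repulsion: the more points are already weighted in the same direction, the smaller is the
  relative change caused by weighting one point more. The set \<open>G\<close> carries arbitrary weights and
  later holds the points of the ball by which the measure is tilted.
\<close>

lemma norm_const_ratio_mono:
  assumes "finite F" "finite G" "insert x (F \<union> G) \<subseteq> E" "x \<notin> F \<union> G" "F \<inter> G = {}"
    and "\<And>z. z \<in> insert x (F \<union> G) \<Longrightarrow> h z > 0"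
    and "\<And>y. y \<in> F \<Longrightarrow> (h x - 1) * (h y - 1) \<ge> 0"
  shows "norm_const h (insert x (F \<union> G)) / norm_const h (F \<union> G)
           \<le> norm_const h (insert x G) / norm_const h G"
  using assms(1,3-)
proof (induction F rule: finite_induct)
  case empty
  then show ?case by simp
next
  case (insert y F)
  have pos: "norm_const h (F \<union> G) > 0" "norm_const h (insert y (F \<union> G)) > 0"
    using insert assms(2) by (auto intro!: norm_const_pos)
  have "norm_const h (F \<union> G) * norm_const h (insert x (insert y (F \<union> G)))
      \<le> norm_const h (insert x (F \<union> G)) * norm_const h (insert y (F \<union> G))"
    using insert.prems insert.hyps assms(2) by (intro norm_const_log_submodular) auto
  then have "norm_const h (insert x (insert y (F \<union> G))) / norm_const h (insert y (F \<union> G))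
      \<le> norm_const h (insert x (F \<union> G)) / norm_const h (F \<union> G)"
    using pos by (simp add: field_simps)
  also have "\<dots> \<le> norm_const h (insert x G) / norm_const h G"
    using insert.prems by (intro insert.IH) auto
  finally show ?case by simp
qed

lemma norm_const_ratio_le_prod:
  assumes "finite F" "finite G" "F \<union> G \<subseteq> E" "F \<inter> G = {}"
    and "\<And>z. z \<in> F \<union> G \<Longrightarrow> h z > 0"
    and "\<And>x y. x \<in> F \<Longrightarrow> y \<in> F \<Longrightarrow> (h x - 1) * (h y - 1) \<ge> 0"
  shows "norm_const h (F \<union> G) / norm_const h G
           \<le> (\<Prod>x\<in>F. norm_const h (insert x G) / norm_const h G)"
  using assms(1,3-)
proof (induction F rule: finite_induct)
  case empty
  then have "norm_const h G > 0"
    using assms(2) by (intro norm_const_pos) auto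
  then show ?case by simp
next
  case (insert x F)
  have pos: "norm_const h (F \<union> G) > 0" "norm_const h (insert x G) > 0" "norm_const h G > 0"
    using insert.prems insert.hyps assms(2) by (auto intro!: norm_const_pos)
  have "norm_const h (insert x (F \<union> G)) / norm_const h (F \<union> G)
           \<le> norm_const h (insert x G) / norm_const h G"
    using insert.prems insert.hyps assms(2) by (intro norm_const_ratio_mono) auto
  moreover have "norm_const h (F \<union> G) / norm_const h G
           \<le> (\<Prod>x\<in>F. norm_const h (insert x G) / norm_const h G)"
    using insert.prems by (intro insert.IH) auto
  ultimately have "norm_const h (insert x (F \<union> G)) / norm_const h (F \<union> G) *
        (norm_const h (F \<union> G) / norm_const h G)
      \<le> norm_const h (insert x G) / norm_const h G *
        (\<Prod>x\<in>F. norm_const h (insert x G) / norm_const h G)"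
    using pos by (intro mult_mono) auto
  then show ?case
    using pos insert.hyps by simp
qed

section \<open>Moment bounds for tilted measures\<close>

definition tilted :: "(real \<Rightarrow> real) \<Rightarrow> real set \<Rightarrow> real set measure" where
  "tilted g G = density P (\<lambda>X. ennreal (mult_func g G X / norm_const g G))"

context
  fixes g :: "real \<Rightarrow> real" and G :: "real set"
  assumes G: "finite G" "G \<subseteq> E" and g_pos: "\<And>x. x \<in> G \<Longrightarrow> g x > 0"
begin

lemma tilt_density_nonneg: "mult_func g G X / norm_const g G \<ge> 0"
  using norm_const_pos[OF G, of g] g_pos
  by (intro divide_nonneg_pos less_imp_le[OF mult_func_pos]) blast+

lemma tilt_density_measurable: "(\<lambda>X. mult_func g G X / norm_const g G) \<in> borel_measurable P"
  using mult_func_measurable[OF G] by simp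

lemma integral_tilted:
  fixes f :: "real set \<Rightarrow> real"
  assumes "f \<in> borel_measurable P"
  shows "(\<integral>X. f X \<partial>tilted g G) = (\<integral>X. mult_func g G X * f X \<partial>P) / norm_const g G"
  unfolding tilted_def
  using integral_real_density[OF tilt_density_measurable _ assms] tilt_density_nonneg by simp

lemma prob_space_tilted: "prob_space (tilted g G)"
proof
  have "emeasure (tilted g G) (space (tilted g G)) =
          (\<integral>\<^sup>+X. ennreal (mult_func g G X / norm_const g G) \<partial>P)"
    unfolding tilted_def using tilt_density_measurable
    by (subst emeasure_density) (auto intro!: nn_integral_cong)
  also have "\<dots> = ennreal (\<integral>X. mult_func g G X / norm_const g G \<partial>P)"
    using integrable_mult_func[OF G] tilt_density_nonneg by (intro nn_integral_eq_integral) auto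
  also have "(\<integral>X. mult_func g G X / norm_const g G \<partial>P) = 1"
    using norm_const_pos[OF G, of g] g_pos by (simp add: norm_const_def[symmetric])
  finally show "emeasure (tilted g G) (space (tilted g G)) = 1" by simp
qed

interpretation \<nu>: prob_space "tilted g G"
  by (rule prob_space_tilted)

definition occupation :: "real \<Rightarrow> real" where
  "occupation x = (\<integral>X. indicator {Y. x \<in> Y} X \<partial>tilted g G)"

lemma sets_tilted [simp, measurable_cong]: "sets (tilted g G) = sets P"
  by (simp add: tilted_def)

lemma integrable_tilted_indicator:
  "x \<in> E \<Longrightarrow> integrable (tilted g G) (indicator {Y. x \<in> Y} :: _ \<Rightarrow> real)"
  by (intro \<nu>.integrable_const_bound[where B = 1]) (auto simp: indicator_def)

lemma integrable_tilted_mult_func: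
  assumes "finite F" "F \<subseteq> E"
  shows "integrable (tilted g G) (mult_func k F)"
  using assms mult_func_measurable[of F k]
  by (intro \<nu>.integrable_const_bound[where B = "\<Prod>x\<in>F. max 1 \<bar>k x\<bar>"])
    (auto intro: abs_mult_func_le)

lemma occupation_bounds: "x \<in> E \<Longrightarrow> 0 \<le> occupation x" "x \<in> E \<Longrightarrow> occupation x \<le> 1"
proof -
  show "0 \<le> occupation x"
    unfolding occupation_def by (intro Bochner_Integration.integral_nonneg) auto
  assume "x \<in> E"
  then have "occupation x \<le> (\<integral>X. 1 \<partial>tilted g G)"
    unfolding occupation_def
    by (intro integral_mono integrable_tilted_indicator) (auto simp: indicator_def)
  then show "occupation x \<le> 1" by (simp add: \<nu>.prob_space)
qed

text \<open>
  The same upper bound as for a Poisson process with intensity \<open>occupation\<close>. Weighting the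
  single point \<open>x\<close> changes the normalization by the factor
  \<open>1 + (k x - 1) * occupation x \<le> exp ((k x - 1) * occupation x)\<close>, and by submodularity these
  factors multiply to an upper bound.
\<close>

lemma tilted_mult_func_le_one_sided:
  assumes F: "finite F" "F \<subseteq> E - G" and k: "\<And>x. x \<in> F \<Longrightarrow> k x > 0"
    and sgn: "\<And>x y. x \<in> F \<Longrightarrow> y \<in> F \<Longrightarrow> (k x - 1) * (k y - 1) \<ge> 0"
  shows "(\<integral>X. mult_func k F X \<partial>tilted g G) \<le> exp (\<Sum>x\<in>F. (k x - 1) * occupation x)"
proof -
  \<comment> \<open>Integrals for the tilted measure become quotients of normalizations for one weight that
    is \<open>g\<close> on \<open>G\<close> and \<open>k\<close> on \<open>F\<close>.\<close>
  define h where "h x = (if x \<in> F then k x else g x)" for x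
  have disj: "F \<inter> G = {}" and sub: "F \<union> G \<subseteq> E"
    using F G by auto
  have hG: "mult_func h G X = mult_func g G X" and hF: "mult_func h F X = mult_func k F X" for X
    using disj by (auto intro!: mult_func_cong simp: h_def)
  have ZG: "norm_const h G = norm_const g G"
    using disj by (intro norm_const_cong) (auto simp: h_def)
  have ratio: "norm_const h (insert x G) / norm_const h G = 1 + (k x - 1) * occupation x"
    if x: "x \<in> F" for x
  proof -
    have xE: "x \<in> E" "x \<notin> G"
      using x F by auto
    have "norm_const h (insert x G) =
        (\<integral>X. mult_func g G X * (1 + (k x - 1) * indicator {Y. x \<in> Y} X) \<partial>P)"
      unfolding norm_const_def mult_func_insert[OF G(1) xE(2)] hG using x by (simp add: h_def)
    also have "\<dots> / norm_const g G = (\<integral>X. 1 + (k x - 1) * indicator {Y. x \<in> Y} X \<partial>tilted g G)"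
      using xE by (intro integral_tilted[symmetric]) simp
    also have "\<dots> = 1 + (k x - 1) * occupation x"
      unfolding occupation_def using integrable_tilted_indicator[OF xE(1)] by (simp add: \<nu>.prob_space)
    finally show ?thesis by (simp add: ZG)
  qed
  have "(\<integral>X. mult_func k F X \<partial>tilted g G) = norm_const h (F \<union> G) / norm_const h G"
    using F G mult_func_measurable[of F k] disj
    by (subst integral_tilted)
       (auto simp: norm_const_def[of h "F \<union> G"] mult_func_Un hG hF ZG mult.commute)
  also have "\<dots> \<le> (\<Prod>x\<in>F. norm_const h (insert x G) / norm_const h G)"
    using F G disj sub k g_pos sgn by (intro norm_const_ratio_le_prod) (auto simp: h_def)
  also have "\<dots> = (\<Prod>x\<in>F. 1 + (k x - 1) * occupation x)"
    by (intro prod.cong) (auto simp: ratio)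
  also have "\<dots> \<le> (\<Prod>x\<in>F. exp ((k x - 1) * occupation x))"
  proof (intro prod_mono conjI exp_ge_add_one_self)
    fix x assume x: "x \<in> F"
    have "norm_const h (insert x G) > 0" "norm_const h G > 0"
      using x F G k g_pos by (auto intro!: norm_const_pos simp: h_def)
    then show "0 \<le> 1 + (k x - 1) * occupation x"
      using ratio[OF x] by (metis divide_nonneg_pos less_imp_le)
  qed
  also have "\<dots> = exp (\<Sum>x\<in>F. (k x - 1) * occupation x)"
    using F by (simp add: exp_sum)
  finally show ?thesis .
qed

text \<open>
  A general weight is a product of one that is at least 1 and one that is at most 1, to whose
  squares the one-sided bound applies. Squaring replaces \<open>k - 1\<close> by \<open>(k\<^sup>2 - 1) / 2\<close>, which
  agrees with it to first order.
\<close>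

lemma tilted_mult_func_le:
  assumes F: "finite F" "F \<subseteq> E - G" and k: "\<And>x. x \<in> F \<Longrightarrow> k x > 0"
  shows "(\<integral>X. mult_func k F X \<partial>tilted g G) \<le> exp (\<Sum>x\<in>F. ((k x)\<^sup>2 - 1) / 2 * occupation x)"
proof -
  define F1 where "F1 = {x\<in>F. k x \<ge> 1}"
  define F2 where "F2 = {x\<in>F. k x < 1}"
  define u where "u F' = (\<Sum>x\<in>F'. ((k x)\<^sup>2 - 1) * occupation x)" for F'
  have parts: "F1 \<union> F2 = F" "F1 \<inter> F2 = {}" "finite F1" "finite F2" "F1 \<subseteq> E - G" "F2 \<subseteq> E - G"
    using F by (auto simp: F1_def F2_def)
  have sq1: "1 \<le> (k x)\<^sup>2" if "x \<in> F1" for x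
    using that by (simp add: F1_def one_le_power)
  have sq2: "(k x)\<^sup>2 \<le> 1" if "x \<in> F2" for x
    using that k[of x] by (auto simp: F2_def intro: power_le_one)
  have "(\<integral>X. mult_func (\<lambda>x. (k x)\<^sup>2) F1 X \<partial>tilted g G) \<le> exp (u F1)"
    unfolding u_def using parts k
    by (intro tilted_mult_func_le_one_sided) (auto simp: sq1 F1_def intro!: zero_less_power)
  then have A: "(\<integral>X. (mult_func k F1 X)\<^sup>2 \<partial>tilted g G) \<le> exp (u F1)"
    by (simp add: mult_func_power)
  have "(\<integral>X. mult_func (\<lambda>x. (k x)\<^sup>2) F2 X \<partial>tilted g G) \<le> exp (u F2)"
    unfolding u_def
  proof (intro tilted_mult_func_le_one_sided parts)
    show "(k x)\<^sup>2 > 0" if "x \<in> F2" for x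
      using that k[of x] by (simp add: F2_def)
  qed (simp add: sq2 mult_nonpos_nonpos)
  then have B: "(\<integral>X. (mult_func k F2 X)\<^sup>2 \<partial>tilted g G) \<le> exp (u F2)"
    by (simp add: mult_func_power)
  have int: "integrable (tilted g G) (\<lambda>X. (mult_func k F' X)\<^sup>2)" if "finite F'" "F' \<subseteq> E" for F'
    using integrable_tilted_mult_func[OF that, of "\<lambda>x. (k x)\<^sup>2"] by (simp add: mult_func_power)
  \<comment> \<open>The value of \<open>s\<close> that balances the two terms on the right of \<open>2 * a * b \<le> s * a\<^sup>2 + b\<^sup>2 / s\<close>.\<close>
  define s where "s = exp ((u F2 - u F1) / 2)"
  have s: "s > 0" "s * exp (u F1) = exp ((u F1 + u F2) / 2)"
      "exp (u F2) / s = exp ((u F1 + u F2) / 2)"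
    by (auto simp: s_def exp_add[symmetric] exp_diff[symmetric] field_simps)
  have le: "mult_func k F X \<le> (s * (mult_func k F1 X)\<^sup>2 + (mult_func k F2 X)\<^sup>2 / s) / 2" for X
  proof -
    let ?a = "mult_func k F1 X" and ?b = "mult_func k F2 X"
    have "mult_func k F X = ?a * ?b"
      using mult_func_Un[OF parts(3,4,2)] parts(1) by simp
    moreover have "0 \<le> (s * ?a - ?b)\<^sup>2 / s"
      using s by simp
    moreover have "(s * ?a - ?b)\<^sup>2 / s = s * ?a\<^sup>2 + ?b\<^sup>2 / s - 2 * (?a * ?b)"
      using s by (simp add: field_simps power2_eq_square)
    ultimately show ?thesis by simp
  qed
  have "F1 \<subseteq> E" "F2 \<subseteq> E" "F \<subseteq> E"
    using parts F by auto
  note int = int[OF parts(3) this(1)] int[OF parts(4) this(2)]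
    integrable_tilted_mult_func[OF F(1) this(3)]
  have int': "integrable (tilted g G) (\<lambda>X. s * (mult_func k F1 X)\<^sup>2)"
      "integrable (tilted g G) (\<lambda>X. (mult_func k F2 X)\<^sup>2 / s)"
    using int by auto
  with int have "integrable (tilted g G)
      (\<lambda>X. (s * (mult_func k F1 X)\<^sup>2 + (mult_func k F2 X)\<^sup>2 / s) / 2)"
    by (intro integrable_divide_zero Bochner_Integration.integrable_add) auto
  then have "(\<integral>X. mult_func k F X \<partial>tilted g G) \<le>
      (\<integral>X. (s * (mult_func k F1 X)\<^sup>2 + (mult_func k F2 X)\<^sup>2 / s) / 2 \<partial>tilted g G)"
    by (intro integral_mono le int)
  also have "\<dots> = (s * (\<integral>X. (mult_func k F1 X)\<^sup>2 \<partial>tilted g G)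
      + (\<integral>X. (mult_func k F2 X)\<^sup>2 \<partial>tilted g G) / s) / 2"
    using int int' by simp
  also have "\<dots> \<le> (s * exp (u F1) + exp (u F2) / s) / 2"
    using A B s(1) by (intro divide_right_mono add_mono mult_left_mono) auto
  also have "\<dots> = exp ((u F1 + u F2) / 2)"
    unfolding s by simp
  also have "u F1 + u F2 = u F"
    using sum.union_disjoint[OF parts(3,4,2), of "\<lambda>x. ((k x)\<^sup>2 - 1) * occupation x"]
    unfolding u_def parts(1) by simp
  also have "u F / 2 = (\<Sum>x\<in>F. ((k x)\<^sup>2 - 1) / 2 * occupation x)"
    by (simp add: u_def sum_divide_distrib)
  finally show ?thesis .
qed

text \<open>
  Jensen's inequality for the exponential function: the logarithm of the product is a sum over
  the occupied points of \<open>F\<close>, its mean is \<open>c\<close>, and \<open>exp\<close> lies above its tangent at \<open>c\<close>.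
\<close>

lemma tilted_mult_func_ge:
  assumes F: "finite F" "F \<subseteq> E" and k: "\<And>x. x \<in> F \<Longrightarrow> k x > 0"
  shows "exp (\<Sum>x\<in>F. ln (k x) * occupation x) \<le> (\<integral>X. mult_func k F X \<partial>tilted g G)"
proof -
  define c where "c = (\<Sum>x\<in>F. ln (k x) * occupation x)"
  define f where "f X = (\<Sum>x\<in>F. ln (k x) * indicator {Y. x \<in> Y} X)" for X :: "real set"
  have int: "integrable (tilted g G) f"
    unfolding f_def[abs_def] using F
    by (intro Bochner_Integration.integrable_sum integrable_mult_right integrable_tilted_indicator) auto
  have "(\<integral>X. f X \<partial>tilted g G) = c"
    unfolding f_def c_def occupation_def using F
    by (subst Bochner_Integration.integral_sum)
       (auto intro!: integrable_mult_right integrable_tilted_indicator)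
  then have "exp c = (\<integral>X. exp c * (1 + (f X - c)) \<partial>tilted g G)"
    using int by (simp add: \<nu>.prob_space)
  also have "\<dots> \<le> (\<integral>X. mult_func k F X \<partial>tilted g G)"
  proof (intro integral_mono integrable_tilted_mult_func F)
    fix X
    have "exp c * (1 + (f X - c)) \<le> exp c * exp (f X - c)"
      by (intro mult_left_mono exp_ge_add_one_self) simp
    also have "\<dots> = mult_func k F X"
      using F k by (simp add: mult_func_eq_exp f_def exp_add[symmetric])
    finally show "exp c * (1 + (f X - c)) \<le> mult_func k F X" .
  qed (use int in auto)
  finally show ?thesis by (simp add: c_def)
qed

text \<open>
  The upper bound for the weight \<open>k\<^sup>2\<close> and the lower bound for \<open>k\<close> have the same first order
  terms in \<open>k - 1\<close>, so the relative variance is controlled by squares. As the occupation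
  probabilities are at most 1, the bound depends on neither the measure nor the tilt.
\<close>

lemma tilted_variance_le:
  assumes F: "finite F" "F \<subseteq> E - G" and k: "\<And>x. x \<in> F \<Longrightarrow> \<bar>k x - 1\<bar> \<le> 1/2"
  defines "z \<equiv> \<integral>X. mult_func k F X \<partial>tilted g G"
  shows "z > 0" "(\<integral>X. (mult_func k F X / z - 1)\<^sup>2 \<partial>tilted g G) \<le> exp (8 * (\<Sum>x\<in>F. (k x - 1)\<^sup>2)) - 1"
proof -
  have FE: "F \<subseteq> E"
    using F by auto
  have kpos: "k x > 0" if "x \<in> F" for x
    using k[OF that] by linarith
  define c where "c = (\<Sum>x\<in>F. ln (k x) * occupation x)"
  have lower: "exp c \<le> z"
    unfolding z_def c_def by (rule tilted_mult_func_ge[OF F(1) FE kpos])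
  then show z: "z > 0"
    by (rule less_le_trans[OF exp_gt_zero])
  define b where "b = (\<integral>X. (mult_func k F X)\<^sup>2 \<partial>tilted g G)"
  have intsq: "integrable (tilted g G) (\<lambda>X. (mult_func k F X)\<^sup>2)"
    using integrable_tilted_mult_func[OF F(1) FE, of "\<lambda>x. (k x)\<^sup>2"] by (simp add: mult_func_power)
  have "b \<le> exp (\<Sum>x\<in>F. (((k x)\<^sup>2)\<^sup>2 - 1) / 2 * occupation x)"
    using tilted_mult_func_le[OF F, of "\<lambda>x. (k x)\<^sup>2"] zero_less_power[OF kpos]
    by (simp add: b_def mult_func_power del: zero_less_power_eq_numeral zero_less_power2)
  moreover have "(exp c)\<^sup>2 \<le> z\<^sup>2"
    using lower by (intro power_mono) auto
  ultimately have "b / z\<^sup>2 \<le> exp (\<Sum>x\<in>F. (((k x)\<^sup>2)\<^sup>2 - 1) / 2 * occupation x) / (exp c)\<^sup>2"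
    using z by (intro frac_le) auto
  also have "\<dots> = exp (\<Sum>x\<in>F. (((k x) ^ 4 - 1) / 2 - 2 * ln (k x)) * occupation x)"
    unfolding c_def exp_double[symmetric] exp_diff[symmetric]
    by (simp add: sum_distrib_left sum_subtractf algebra_simps)
  also have "\<dots> \<le> exp (8 * (\<Sum>x\<in>F. (k x - 1)\<^sup>2))"
  proof (subst exp_le_cancel_iff, subst sum_distrib_left, rule sum_mono)
    fix x assume x: "x \<in> F"
    then have q: "0 \<le> occupation x" "occupation x \<le> 1"
      using F by (auto intro!: occupation_bounds)
    have "((k x ^ 4 - 1) / 2 - 2 * ln (k x)) * occupation x \<le> 8 * (k x - 1)\<^sup>2 * occupation x"
      using log_ratio_bound[OF k[OF x]] q by (intro mult_right_mono)
    also have "\<dots> \<le> 8 * (k x - 1)\<^sup>2"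
      using q by (intro mult_left_le) auto
    finally show "((k x ^ 4 - 1) / 2 - 2 * ln (k x)) * occupation x \<le> 8 * (k x - 1)\<^sup>2" .
  qed
  finally have bound: "b / z\<^sup>2 \<le> exp (8 * (\<Sum>x\<in>F. (k x - 1)\<^sup>2))" .
  have "(\<integral>X. (mult_func k F X / z - 1)\<^sup>2 \<partial>tilted g G) =
      (\<integral>X. (mult_func k F X)\<^sup>2 / z\<^sup>2 - 2 / z * mult_func k F X + 1 \<partial>tilted g G)"
    using z by (intro Bochner_Integration.integral_cong) (auto simp: field_simps power2_eq_square)
  also have "\<dots> = b / z\<^sup>2 - 2 / z * z + 1"
    using intsq integrable_tilted_mult_func[OF F(1) FE]
    by (simp add: b_def z_def \<nu>.prob_space)
  finally show "(\<integral>X. (mult_func k F X / z - 1)\<^sup>2 \<partial>tilted g G) \<le> exp (8 * (\<Sum>x\<in>F. (k x - 1)\<^sup>2)) - 1"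
    using bound z by simp
qed

end

text \<open>
  The normalized product over \<open>G \<union> F\<close> is the one over \<open>G\<close>, which is the density of the tilted
  measure, times \<open>mult_func h F X / z\<close>, where \<open>z\<close> is the tilted mean of \<open>mult_func h F\<close>. So the
  increment is a mean deviation under the tilted measure and is bounded by the variance.
\<close>

lemma normalized_mult_func_L1_increment:
  assumes F: "finite F" "F \<subseteq> E - G" and G: "finite G" "G \<subseteq> E"
    and pos: "\<And>x. x \<in> G \<Longrightarrow> h x > 0" and near: "\<And>x. x \<in> F \<Longrightarrow> \<bar>h x - 1\<bar> \<le> 1/2"
    and \<delta>: "\<delta> > 0" "exp (8 * (\<Sum>x\<in>F. (h x - 1)\<^sup>2)) - 1 \<le> \<delta>\<^sup>2"
  shows "(\<integral>X. \<bar>mult_func h (G \<union> F) X / norm_const h (G \<union> F) - mult_func h G X / norm_const h G\<bar> \<partial>P) \<le> \<delta>"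
proof -
  interpret \<nu>: prob_space "tilted h G"
    by (rule prob_space_tilted[OF G pos])
  define z where "z = (\<integral>X. mult_func h F X \<partial>tilted h G)"
  have z: "z > 0" and var: "(\<integral>X. (mult_func h F X / z - 1)\<^sup>2 \<partial>tilted h G) \<le> \<delta>\<^sup>2"
    unfolding z_def using tilted_variance_le[where g = h and k = h, OF G _ F] pos near
    by (blast, intro order_trans[OF _ \<delta>(2)]) blast
  have FE: "F \<subseteq> E" and disj: "G \<inter> F = {}"
    using F by auto
  have ZG: "norm_const h G > 0"
    by (rule norm_const_pos[OF G pos])
  have meas: "mult_func h F \<in> borel_measurable P"
    by (rule mult_func_measurable[OF F(1) FE])
  have "z = norm_const h (G \<union> F) / norm_const h G"
    unfolding z_def norm_const_def[of h "G \<union> F"] mult_func_Un[OF G(1) F(1) disj]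
    by (rule integral_tilted[OF G _ meas]) (rule pos)
  then have ZU: "norm_const h (G \<union> F) = norm_const h G * z"
    using ZG by (simp add: field_simps)
  have weighted: "\<bar>mult_func h (G \<union> F) X / norm_const h (G \<union> F) - mult_func h G X / norm_const h G\<bar> =
      mult_func h G X * \<bar>mult_func h F X / z - 1\<bar> / norm_const h G" for X
  proof -
    have "mult_func h (G \<union> F) X / norm_const h (G \<union> F) - mult_func h G X / norm_const h G =
        mult_func h G X / norm_const h G * (mult_func h F X / z - 1)"
      unfolding ZU mult_func_Un[OF G(1) F(1) disj] using z ZG by (simp add: field_simps)
    moreover have "mult_func h G X > 0"
      using pos by (rule mult_func_pos)
    ultimately show ?thesis
      using ZG by (simp add: abs_mult)
  qed
  have "integrable (tilted h G) (mult_func k F)" for k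
    by (rule integrable_tilted_mult_func[OF G _ F(1) FE]) (rule pos)
  from this[of h] this[of "\<lambda>x. (h x)\<^sup>2"] have int: "integrable (tilted h G) (mult_func h F)"
      "integrable (tilted h G) (\<lambda>X. (mult_func h F X)\<^sup>2)"
    unfolding mult_func_power .
  have "(mult_func h F X / z - 1)\<^sup>2 = (mult_func h F X)\<^sup>2 / z\<^sup>2 - 2 / z * mult_func h F X + 1" for X
    using z by (simp add: field_simps power2_eq_square)
  with int have int_sq: "integrable (tilted h G) (\<lambda>X. (mult_func h F X / z - 1)\<^sup>2)"
    by simp
  from weighted have "(\<integral>X. \<bar>mult_func h (G \<union> F) X / norm_const h (G \<union> F) - mult_func h G X / norm_const h G\<bar> \<partial>P) =
      (\<integral>X. \<bar>mult_func h F X / z - 1\<bar> \<partial>tilted h G)"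
    using meas pos by (subst integral_tilted[OF G]) simp_all
  \<comment> \<open>From \<open>2 * t \<le> \<delta> + t\<^sup>2 / \<delta>\<close>, in place of the Cauchy-Schwarz inequality.\<close>
  also have "\<dots> \<le> (\<integral>X. (\<delta> + (mult_func h F X / z - 1)\<^sup>2 / \<delta>) / 2 \<partial>tilted h G)"
  proof (rule integral_mono)
    show "integrable (tilted h G) (\<lambda>X. \<bar>mult_func h F X / z - 1\<bar>)"
      using int by auto
    show "integrable (tilted h G) (\<lambda>X. (\<delta> + (mult_func h F X / z - 1)\<^sup>2 / \<delta>) / 2)"
      using int_sq by simp
    fix X
    have "0 \<le> (\<delta> - \<bar>mult_func h F X / z - 1\<bar>)\<^sup>2 / \<delta>"
      using \<delta>(1) by simp
    also have "\<dots> = \<delta> + (mult_func h F X / z - 1)\<^sup>2 / \<delta> - 2 * \<bar>mult_func h F X / z - 1\<bar>"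
      using \<delta>(1) by (simp add: power2_diff diff_divide_distrib add_divide_distrib) (simp add: power2_eq_square)
    finally show "\<bar>mult_func h F X / z - 1\<bar> \<le> (\<delta> + (mult_func h F X / z - 1)\<^sup>2 / \<delta>) / 2"
      by simp
  qed
  also have "\<dots> = (\<delta> + (\<integral>X. (mult_func h F X / z - 1)\<^sup>2 \<partial>tilted h G) / \<delta>) / 2"
    using int_sq by (simp add: \<nu>.prob_space)
  also have "\<dots> \<le> (\<delta> + \<delta>\<^sup>2 / \<delta>) / 2"
    using var \<delta>(1) by (intro divide_right_mono add_left_mono) auto
  also have "\<dots> = \<delta>"
    using \<delta>(1) by (simp add: power2_eq_square)
  finally show ?thesis .
qed

text \<open>
  With weight 2 at the single point \<open>q\<close>, the determinant says that \<open>1 + K q q\<close> is one plus the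
  probability of \<open>q \<in> X\<close>.
\<close>

lemma AE_unoccupied:
  assumes q: "q \<in> E" and "K q q = 0"
  shows "AE X in P. q \<notin> X"
proof -
  have "complex_of_real (norm_const (\<lambda>_. 2) {q}) = 1"
    using norm_const_eq_det[of "{q}" "\<lambda>_. 2"] assms by (simp add: det_on_tilt_singleton)
  then have "norm_const (\<lambda>_. 2) {q} = 1"
    by simp
  moreover have "mult_func (\<lambda>_. 2) {q} = (\<lambda>X. 1 + indicator {Y. q \<in> Y} X)"
    by (auto simp: mult_func_alt)
  moreover have int: "integrable P (indicator {Y. q \<in> Y} :: _ \<Rightarrow> real)"
    using q by (intro integrable_const_bound[where B = 1]) (auto simp: indicator_def)
  ultimately have "(\<integral>X. indicator {Y. q \<in> Y} X \<partial>P) = (0 :: real)"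
    by (simp add: norm_const_def prob_space)
  then have "AE X in P. indicator {Y. q \<in> Y} X = (0 :: real)"
    using int by (subst (asm) integral_nonneg_eq_0_iff_AE) auto
  then show ?thesis
    by eventually_elim (simp add: indicator_def)
qed

end

section \<open>The orthogonal projection onto the pinned subspace\<close>

lemma l2_mult_summable:
  assumes "f \<in> l2_space E" "g \<in> l2_space E"
  shows "(\<lambda>x. f x * cnj (g x)) summable_on E"
proof (rule abs_summable_summable, rule summable_on_comparison_test)
  show "(\<lambda>x. ((cmod (f x))\<^sup>2 + (cmod (g x))\<^sup>2)) summable_on E"
    using assms by (intro summable_on_add) (auto simp: l2_space_def)
  show "norm (f x * cnj (g x)) \<le> (cmod (f x))\<^sup>2 + (cmod (g x))\<^sup>2" for x
  proof -
    have "cmod (f x) * cmod (g x) * 2 \<le> (cmod (f x))\<^sup>2 + (cmod (g x))\<^sup>2"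
      using sum_squares_bound[of "cmod (f x)" "cmod (g x)"] by simp
    moreover have "0 \<le> cmod (f x) * cmod (g x)"
      by simp
    ultimately have "cmod (f x) * cmod (g x) \<le> (cmod (f x))\<^sup>2 + (cmod (g x))\<^sup>2"
      by linarith
    then show ?thesis
      by (simp add: norm_mult)
  qed
qed auto

lemma l2_space_add_scaled:
  assumes "f \<in> l2_space E" "g \<in> l2_space E"
  shows "(\<lambda>x. f x + c * g x) \<in> l2_space E"
proof -
  have "(\<lambda>x. (cmod (f x + c * g x))\<^sup>2) summable_on E"
  proof (rule summable_on_comparison_test)
    show "(\<lambda>x. 2 * (cmod (f x))\<^sup>2 + (2 * (cmod c)\<^sup>2) * (cmod (g x))\<^sup>2) summable_on E"
      using assms by (intro summable_on_add summable_on_cmult_right) (auto simp: l2_space_def)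
    show "(cmod (f x + c * g x))\<^sup>2 \<le> 2 * (cmod (f x))\<^sup>2 + (2 * (cmod c)\<^sup>2) * (cmod (g x))\<^sup>2" for x
    proof -
      let ?a = "cmod (f x)" and ?b = "cmod c * cmod (g x)"
      have "(cmod (f x + c * g x))\<^sup>2 \<le> (?a + ?b)\<^sup>2"
        by (intro power_mono) (auto intro: norm_triangle_le simp: norm_mult)
      also have "\<dots> \<le> 2 * ?a\<^sup>2 + 2 * ?b\<^sup>2"
        using sum_squares_bound[of ?a ?b] by (simp add: power2_sum)
      finally show ?thesis
        by (simp add: power_mult_distrib)
    qed
  qed auto
  then show ?thesis
    using assms by (simp add: l2_space_def)
qed

definition unit_vec :: "real \<Rightarrow> real \<Rightarrow> complex" where
  "unit_vec q = (\<lambda>z. if z = q then 1 else 0)"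

lemma unit_vec_in_l2:
  assumes "q \<in> E"
  shows "unit_vec q \<in> l2_space E"
proof -
  have "(\<lambda>x. (cmod (unit_vec q x))\<^sup>2) summable_on {q}"
    by simp
  then have "(\<lambda>x. (cmod (unit_vec q x))\<^sup>2) summable_on E"
    by (rule summable_on_cong_neutral[THEN iffD1, rotated -1]) (use assms in \<open>auto simp: unit_vec_def\<close>)
  then show ?thesis
    using assms by (auto simp: l2_space_def unit_vec_def)
qed

lemma l2_inner_unit_vec:
  assumes "q \<in> E"
  shows "l2_inner E f (unit_vec q) = f q"
proof -
  have "l2_inner E f (unit_vec q) = infsum (\<lambda>x. f x * cnj (unit_vec q x)) {q}"
    unfolding l2_inner_def using assms by (intro infsum_cong_neutral) (auto simp: unit_vec_def)
  then show ?thesis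
    by (simp add: unit_vec_def)
qed

lemma l2_inner_cnj: "l2_inner E g f = cnj (l2_inner E f g)"
  unfolding l2_inner_def infsum_cnj[symmetric] by (simp add: mult.commute)

lemma l2_inner_add_scaled_left:
  assumes "f \<in> l2_space E" "g \<in> l2_space E" "h \<in> l2_space E"
  shows "l2_inner E (\<lambda>x. f x + c * g x) h = l2_inner E f h + c * l2_inner E g h"
proof -
  have "l2_inner E (\<lambda>x. f x + c * g x) h =
      (\<Sum>\<^sub>\<infinity>x\<in>E. f x * cnj (h x) + c * (g x * cnj (h x)))"
    by (simp add: l2_inner_def algebra_simps)
  also have "\<dots> = l2_inner E f h + c * l2_inner E g h"
    unfolding l2_inner_def using assms
    by (subst infsum_add) (auto intro!: summable_on_cmult_right l2_mult_summable simp: infsum_cmult_right')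
  finally show ?thesis .
qed

lemma l2_inner_diff_left:
  assumes "f \<in> l2_space E" "g \<in> l2_space E" "h \<in> l2_space E"
  shows "l2_inner E (\<lambda>x. f x - g x) h = l2_inner E f h - l2_inner E g h"
  using l2_inner_add_scaled_left[OF assms, of "-1"] by simp

lemma l2_inner_self_eq_0D:
  assumes f: "f \<in> l2_space E" and 0: "l2_inner E f f = 0"
  shows "f = (\<lambda>x. 0)"
proof
  fix x
  have eq: "f y * cnj (f y) = of_real ((cmod (f y))\<^sup>2)" for y
    by (rule complex_norm_square[symmetric])
  have "l2_inner E f f = of_real (\<Sum>\<^sub>\<infinity>y\<in>E. (cmod (f y))\<^sup>2)"
    unfolding l2_inner_def eq using f
    by (intro infsumI has_sum_of_real has_sum_infsum) (simp add: l2_space_def)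
  then have "(\<Sum>\<^sub>\<infinity>y\<in>E. (cmod (f y))\<^sup>2) = 0"
    using 0 by simp
  then have "x \<in> E \<Longrightarrow> (cmod (f x))\<^sup>2 = 0"
    using f by (intro nonneg_infsum_le_0D[where A = E]) (auto simp: l2_space_def)
  then show "f x = 0"
    using f by (cases "x \<in> E") (auto simp: l2_space_def)
qed

text \<open>
  Linear subspaces onto which an orthogonal projection exists. Closedness is replaced by this
  property because it can be carried through the construction of the pinned subspace by
  explicit formulas. Closure under \<open>f + c g\<close> covers sums, scalar multiples and, for nonempty
  sets, the zero function.
\<close>

definition complemented :: "real set \<Rightarrow> (real \<Rightarrow> complex) set \<Rightarrow> bool" where
  "complemented E M \<longleftrightarrow> M \<subseteq> l2_space E \<and>
     (\<forall>f\<in>M. \<forall>g\<in>M. \<forall>c. (\<lambda>x. f x + c * g x) \<in> M) \<and>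
     (\<forall>f\<in>l2_space E. \<exists>g\<in>M. \<forall>h\<in>M. l2_inner E f h = l2_inner E g h)"

lemma complementedD:
  assumes "complemented E M"
  shows "f \<in> M \<Longrightarrow> f \<in> l2_space E"
    and "f \<in> M \<Longrightarrow> g \<in> M \<Longrightarrow> (\<lambda>x. f x + c * g x) \<in> M"
    and "f \<in> l2_space E \<Longrightarrow> \<exists>g\<in>M. \<forall>h\<in>M. l2_inner E f h = l2_inner E g h"
  using assms by (auto simp: complemented_def)

text \<open>
  The definite description is well defined: the difference of two candidates lies in \<open>M\<close> and is
  orthogonal to \<open>M\<close>, hence to itself.
\<close>

lemma orth_proj_complemented:
  assumes M: "complemented E M" and f: "f \<in> l2_space E"
  shows "orth_proj E M f \<in> M"
    and "h \<in> M \<Longrightarrow> l2_inner E f h = l2_inner E (orth_proj E M f) h"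
proof -
  let ?Q = "\<lambda>g. g \<in> M \<and> (\<forall>h\<in>M. l2_inner E (\<lambda>x. f x - g x) h = 0)"
  have Q: "?Q g \<longleftrightarrow> g \<in> M \<and> (\<forall>h\<in>M. l2_inner E f h = l2_inner E g h)" for g
    using l2_inner_diff_left[OF f] complementedD(1)[OF M] by auto
  obtain g where g: "?Q g"
    using complementedD(3)[OF M f] Q by blast
  have "?Q (THE g. ?Q g)"
  proof (rule theI[where P = ?Q and a = g])
    show "?Q g"
      by (rule g)
  next
    fix g' assume g': "?Q g'"
    let ?d = "\<lambda>x. g' x + (-1) * g x"
    have d: "?d \<in> M"
      using g g' by (intro complementedD(2)[OF M]) auto
    have "l2_inner E ?d ?d = l2_inner E g' ?d + (-1) * l2_inner E g ?d"
      using g g' d by (intro l2_inner_add_scaled_left complementedD(1)[OF M]) auto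
    also have "l2_inner E g' ?d = l2_inner E g ?d"
      using g g' d unfolding Q by metis
    finally have "?d = (\<lambda>x. 0)"
      using d by (intro l2_inner_self_eq_0D[of _ E]) (auto intro: complementedD(1)[OF M])
    then show "g' = g"
      by (auto simp: fun_eq_iff)
  qed
  then have "?Q (orth_proj E M f)"
    unfolding orth_proj_def .
  then show "orth_proj E M f \<in> M"
    and "h \<in> M \<Longrightarrow> l2_inner E f h = l2_inner E (orth_proj E M f) h"
    unfolding Q by auto
qed

text \<open>
  The kernel is the Gram matrix of the projections \<open>?k z\<close> of the unit vectors.
\<close>

lemma proj_kernel_hermitian:
  assumes M: "complemented E M" and "x \<in> E" "y \<in> E"
  shows "proj_kernel E M y x = cnj (proj_kernel E M x y)"
proof -
  let ?k = "\<lambda>z. orth_proj E M (unit_vec z)"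
  have k: "?k z \<in> M" "h \<in> M \<Longrightarrow> l2_inner E (unit_vec z) h = l2_inner E (?k z) h" if "z \<in> E" for z h
    using orth_proj_complemented[OF M unit_vec_in_l2[OF that]] by auto
  have eq: "proj_kernel E M w z = l2_inner E (?k z) (?k w)" if "w \<in> E" "z \<in> E" for w z
  proof -
    have "proj_kernel E M w z = l2_inner E (?k z) (unit_vec w)"
      using that by (simp add: l2_inner_unit_vec) (simp add: proj_kernel_def unit_vec_def)
    also have "\<dots> = cnj (l2_inner E (unit_vec w) (?k z))"
      by (rule l2_inner_cnj)
    also have "\<dots> = l2_inner E (?k z) (?k w)"
      using k(2)[OF that(1) k(1)[OF that(2)]] l2_inner_cnj by metis
    finally show ?thesis .
  qed
  show ?thesis
    using assms by (simp add: eq) (rule l2_inner_cnj)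
qed

lemma proj_kernel_vanishes:
  assumes "complemented E M" "y \<in> E" "\<And>f. f \<in> M \<Longrightarrow> f q = 0"
  shows "proj_kernel E M q y = 0"
  using assms(3)[OF orth_proj_complemented(1)[OF assms(1) unit_vec_in_l2[OF assms(2)]]]
  by (simp add: proj_kernel_def unit_vec_def)

lemma complemented_kernel_range:
  assumes K: "orthogonal_projection_kernel E K"
  shows "complemented E (kernel_range E K)"
  unfolding complemented_def
proof (intro conjI ballI allI)
  have sum: "x \<in> E \<Longrightarrow> (\<lambda>y. K x y * f y) summable_on E" and l2: "kernel_op E K f \<in> l2_space E"
    and idem: "kernel_op E K (kernel_op E K f) = kernel_op E K f"
    if "f \<in> l2_space E" for f x
    using K that by (auto simp: orthogonal_projection_kernel_def)
  have sym: "l2_inner E (kernel_op E K f) g = l2_inner E f (kernel_op E K g)"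
    if "f \<in> l2_space E" "g \<in> l2_space E" for f g
    using K that by (auto simp: orthogonal_projection_kernel_def)
  show "kernel_range E K \<subseteq> l2_space E"
    using l2 by (auto simp: kernel_range_def)
  fix c f assume f: "f \<in> kernel_range E K"
  then obtain f' where f': "f' \<in> l2_space E" "f = kernel_op E K f'"
    by (auto simp: kernel_range_def)
  fix g assume "g \<in> kernel_range E K"
  then obtain g' where g': "g' \<in> l2_space E" "g = kernel_op E K g'"
    by (auto simp: kernel_range_def)
  have "(\<Sum>\<^sub>\<infinity>y\<in>E. K x y * (f' y + c * g' y)) =
      (\<Sum>\<^sub>\<infinity>y\<in>E. K x y * f' y) + c * (\<Sum>\<^sub>\<infinity>y\<in>E. K x y * g' y)" if "x \<in> E" for x
  proof -
    have "(\<Sum>\<^sub>\<infinity>y\<in>E. K x y * (f' y + c * g' y)) = (\<Sum>\<^sub>\<infinity>y\<in>E. K x y * f' y + c * (K x y * g' y))"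
      by (simp add: algebra_simps)
    then show ?thesis
      using sum[OF f'(1) that] sum[OF g'(1) that]
      by (simp add: infsum_add summable_on_cmult_right infsum_cmult_right')
  qed
  then have "(\<lambda>x. f x + c * g x) = kernel_op E K (\<lambda>x. f' x + c * g' x)"
    by (auto simp: f' g' kernel_op_def fun_eq_iff)
  then show "(\<lambda>x. f x + c * g x) \<in> kernel_range E K"
    using l2_space_add_scaled[OF f'(1) g'(1)] by (simp add: kernel_range_def)
next
  fix f assume f: "f \<in> l2_space E"
  show "\<exists>g\<in>kernel_range E K. \<forall>h\<in>kernel_range E K. l2_inner E f h = l2_inner E g h"
  proof (intro bexI ballI)
    show "kernel_op E K f \<in> kernel_range E K"
      using f by (simp add: kernel_range_def)
    fix h assume "h \<in> kernel_range E K"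
    then obtain h' where h': "h' \<in> l2_space E" "h = kernel_op E K h'"
      by (auto simp: kernel_range_def)
    have sym: "l2_inner E (kernel_op E K u) v = l2_inner E u (kernel_op E K v)"
      if "u \<in> l2_space E" "v \<in> l2_space E" for u v
      using K that by (auto simp: orthogonal_projection_kernel_def)
    have "kernel_op E K f \<in> l2_space E" "kernel_op E K (kernel_op E K f) = kernel_op E K f"
      using K f by (auto simp: orthogonal_projection_kernel_def)
    then show "l2_inner E f h = l2_inner E (kernel_op E K f) h"
      using sym[of f h'] sym[of "kernel_op E K f" h'] f h' by simp
  qed
qed

text \<open>
  On \<open>M\<close>, evaluation at \<open>q\<close> is the inner product with the projection \<open>e\<close> of the unit vector at
  \<open>q\<close>. Hence \<open>e\<close> is orthogonal to all members of \<open>M\<close> vanishing at \<open>q\<close>, and a suitable multiple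
  of it corrects the projection onto \<open>M\<close>.
\<close>

lemma complemented_vanishing_at:
  assumes M: "complemented E M" and q: "q \<in> E"
  shows "complemented E {\<phi>\<in>M. \<phi> q = 0}"
  unfolding complemented_def
proof (intro conjI ballI allI)
  fix f assume f: "f \<in> l2_space E"
  obtain g where g: "g \<in> M" "\<And>h. h \<in> M \<Longrightarrow> l2_inner E f h = l2_inner E g h"
    using complementedD(3)[OF M f] by blast
  obtain e where e: "e \<in> M" "\<And>h. h \<in> M \<Longrightarrow> l2_inner E (unit_vec q) h = l2_inner E e h"
    using complementedD(3)[OF M unit_vec_in_l2[OF q]] by blast
  have eval: "l2_inner E e h = cnj (h q)" if "h \<in> M" for h
    using e(2)[OF that] l2_inner_cnj[of E "unit_vec q" h] l2_inner_unit_vec[OF q, of h] by simp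
  show "\<exists>g\<in>{\<phi>\<in>M. \<phi> q = 0}. \<forall>h\<in>{\<phi>\<in>M. \<phi> q = 0}. l2_inner E f h = l2_inner E g h"
  \<comment> \<open>\<open>e q\<close> is the squared norm of \<open>e\<close>; if it is 0, every member of \<open>M\<close> vanishes at \<open>q\<close>.\<close>
  proof (cases "e q = 0")
    case True
    then have "e = (\<lambda>x. 0)"
      using eval[OF e(1)] e(1) by (intro l2_inner_self_eq_0D[of _ E]) (auto intro: complementedD(1)[OF M])
    then have "h q = 0" if "h \<in> M" for h
      using eval[OF that] by (simp add: l2_inner_def)
    then show ?thesis
      using g by blast
  next
    case False
    let ?g = "\<lambda>x. g x + (- (g q / e q)) * e x"
    have "?g \<in> M"
      by (rule complementedD(2)[OF M g(1) e(1)])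
    moreover have "l2_inner E f h = l2_inner E ?g h" if "h \<in> M" "h q = 0" for h
      using that g e l2_inner_add_scaled_left[of g E e h "- (g q / e q)"] eval[of h]
        complementedD(1)[OF M] by simp
    ultimately show ?thesis
      using False by (intro bexI[of _ ?g]) auto
  qed
qed (use complementedD(1,2)[OF M] in auto)

text \<open>
  Let \<open>e\<close> be the projection of the unit vector at \<open>q\<close>. Then \<open>1 - e q\<close> is the squared norm of
  the difference. If it is 0, the unit vector belongs to \<open>M\<close>, and erasing the value at \<open>q\<close> has
  the same effect as requiring it to be 0. Otherwise the function in \<open>M\<close> whose erasure is the
  projection of \<open>f\<close> is found among the functions \<open>g - c * e\<close>, where \<open>g\<close> is the projection of
  \<open>f\<close> onto \<open>M\<close>.
\<close>

lemma complemented_erasing_at: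
  assumes M: "complemented E M" and q: "q \<in> E"
  shows "complemented E ((\<lambda>\<phi>. \<phi>(q := 0)) ` M)"
proof -
  define er :: "(real \<Rightarrow> complex) \<Rightarrow> real \<Rightarrow> complex" where "er \<phi> = \<phi>(q := 0)" for \<phi>
  have er_alt: "er \<phi> = (\<lambda>x. \<phi> x + (- \<phi> q) * unit_vec q x)" for \<phi>
    by (auto simp: er_def unit_vec_def)
  have er_l2: "er \<phi> \<in> l2_space E" if "\<phi> \<in> l2_space E" for \<phi>
    unfolding er_alt by (intro l2_space_add_scaled that unit_vec_in_l2 q)
  obtain e where e: "e \<in> M" "\<And>h. h \<in> M \<Longrightarrow> l2_inner E (unit_vec q) h = l2_inner E e h"
    using complementedD(3)[OF M unit_vec_in_l2[OF q]] by blast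
  show ?thesis
  proof (cases "e q = 1")
    case True
    have e_l2: "e \<in> l2_space E"
      by (rule complementedD(1)[OF M e(1)])
    let ?u = "\<lambda>x. unit_vec q x + (-1) * e x"
    have u: "?u \<in> l2_space E"
      by (intro l2_space_add_scaled unit_vec_in_l2 q e_l2)
    have "l2_inner E ?u ?u = l2_inner E (unit_vec q) ?u + (-1) * l2_inner E e ?u"
      by (intro l2_inner_add_scaled_left unit_vec_in_l2 q e_l2 u)
    moreover have "l2_inner E (unit_vec q) ?u = 0"
      using l2_inner_cnj[of E "unit_vec q" ?u] l2_inner_unit_vec[OF q, of ?u] True
      by (simp add: unit_vec_def)
    moreover have "l2_inner E ?u e = l2_inner E (unit_vec q) e + (-1) * l2_inner E e e"
      by (intro l2_inner_add_scaled_left unit_vec_in_l2 q e_l2)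
    then have "l2_inner E e ?u = 0"
      using e(2)[OF e(1)] l2_inner_cnj[of E e ?u] by simp
    ultimately have "?u = (\<lambda>x. 0)"
      using u by (intro l2_inner_self_eq_0D[of _ E]) auto
    then have "unit_vec q = e"
      by (auto simp: fun_eq_iff)
    then have "unit_vec q \<in> M"
      using e by simp
    then have "er \<phi> \<in> M" if "\<phi> \<in> M" for \<phi>
      unfolding er_alt by (rule complementedD(2)[OF M that])
    then have "er \<phi> \<in> {\<phi>\<in>M. \<phi> q = 0}" if "\<phi> \<in> M" for \<phi>
      using that by (simp add: er_def)
    moreover have "\<phi> = er \<phi>" if "\<phi> q = 0" for \<phi>
      using that by (auto simp: er_def)
    ultimately have "er ` M = {\<phi>\<in>M. \<phi> q = 0}"
      by (auto simp: image_iff)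
    then show ?thesis
      using complemented_vanishing_at[OF M q] by (simp add: er_def[abs_def])
  next
    case False
    have adj: "l2_inner E \<phi> (er \<psi>) = l2_inner E \<phi> \<psi> - \<phi> q * cnj (\<psi> q)"
      if "\<phi> \<in> l2_space E" "\<psi> \<in> l2_space E" for \<phi> \<psi>
    proof -
      have "l2_inner E (er \<psi>) \<phi> = l2_inner E \<psi> \<phi> + (- \<psi> q) * l2_inner E (unit_vec q) \<phi>"
        unfolding er_alt by (intro l2_inner_add_scaled_left that unit_vec_in_l2 q)
      moreover have "l2_inner E (unit_vec q) \<phi> = cnj (\<phi> q)"
        using l2_inner_cnj[of E "unit_vec q" \<phi>] l2_inner_unit_vec[OF q, of \<phi>] by simp
      ultimately show ?thesis
        using l2_inner_cnj[of E \<phi> "er \<psi>"] l2_inner_cnj[of E \<phi> \<psi>] by simp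
    qed
    have "complemented E (er ` M)"
      unfolding complemented_def
    proof (intro conjI ballI allI)
      show "er ` M \<subseteq> l2_space E"
        using er_l2 complementedD(1)[OF M] by auto
      fix f g c assume "f \<in> er ` M" "g \<in> er ` M"
      then obtain f' g' where fg: "f' \<in> M" "f = er f'" "g' \<in> M" "g = er g'"
        by auto
      then have "(\<lambda>x. f x + c * g x) = er (\<lambda>x. f' x + c * g' x)"
        by (auto simp: er_def fun_eq_iff)
      then show "(\<lambda>x. f x + c * g x) \<in> er ` M"
        using fg complementedD(2)[OF M fg(1,3), of c] by simp
    next
      fix f assume f: "f \<in> l2_space E"
      obtain g where g: "g \<in> M" "\<And>h. h \<in> M \<Longrightarrow> l2_inner E f h = l2_inner E g h"
        using complementedD(3)[OF M f] by blast
      \<comment> \<open>Orthogonality to the erased functions amounts to \<open>c = f q - \<phi> q\<close>, a linear equation for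
        \<open>c\<close> because \<open>\<phi> q = g q - c * e q\<close>.\<close>
      define c where "c = (f q - g q) / (1 - e q)"
      define \<phi> where "\<phi> = (\<lambda>x. g x + (- c) * e x)"
      have \<phi>: "\<phi> \<in> M"
        unfolding \<phi>_def by (rule complementedD(2)[OF M g(1) e(1)])
      have c: "c = f q - \<phi> q"
        using False by (simp add: \<phi>_def c_def field_simps)
      have "l2_inner E f (er \<psi>) = l2_inner E (er \<phi>) (er \<psi>)" if \<psi>: "\<psi> \<in> M" for \<psi>
      proof -
        have l2: "\<phi> \<in> l2_space E" "\<psi> \<in> l2_space E" "g \<in> l2_space E" "e \<in> l2_space E"
          using \<phi> \<psi> g e complementedD(1)[OF M] by auto
        have "l2_inner E e \<psi> = cnj (\<psi> q)"
          using e(2)[OF \<psi>] l2_inner_cnj[of E "unit_vec q" \<psi>] l2_inner_unit_vec[OF q, of \<psi>] by simp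
        then have "l2_inner E \<phi> \<psi> = l2_inner E f \<psi> - c * cnj (\<psi> q)"
          unfolding \<phi>_def l2_inner_add_scaled_left[OF l2(3,4,2)] using g(2)[OF \<psi>] by simp
        then have "l2_inner E f (er \<psi>) = l2_inner E \<phi> (er \<psi>)"
          using l2 f by (simp add: adj c algebra_simps)
        also have "\<dots> = l2_inner E (er \<phi>) (er \<psi>)"
          by (simp add: l2_inner_def er_def) (intro infsum_cong, simp)
        finally show ?thesis .
      qed
      then show "\<exists>g\<in>er ` M. \<forall>h\<in>er ` M. l2_inner E f h = l2_inner E g h"
        using \<phi> by blast
    qed
    then show ?thesis
      by (simp add: er_def[abs_def])
  qed
qed

lemma complemented_pinned_subspace:
  assumes L: "complemented E L" and p: "p ` {1..l} \<subseteq> E" and "m \<le> l"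
  shows "complemented E (pinned_subspace E L p m l)"
proof -
  have van: "complemented E {\<phi>\<in>L. \<forall>q\<in>Q. \<phi> q = 0}" if "finite Q" "Q \<subseteq> E" for Q
    using that
  proof (induction Q rule: finite_induct)
    case empty
    then show ?case using L by simp
  next
    case (insert q Q)
    then have "complemented E {\<phi>\<in>{\<phi>\<in>L. \<forall>q\<in>Q. \<phi> q = 0}. \<phi> q = 0}"
      by (intro complemented_vanishing_at) auto
    also have "{\<phi>\<in>{\<phi>\<in>L. \<forall>q\<in>Q. \<phi> q = 0}. \<phi> q = 0} = {\<phi>\<in>L. \<forall>q\<in>insert q Q. \<phi> q = 0}"
      by auto
    finally show ?case .
  qed
  have era: "complemented E ((\<lambda>\<phi> x. indicator (E - Q) x * \<phi> x) ` M)"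
    if "finite Q" "Q \<subseteq> E" and M: "complemented E M" for Q M
    using that(1,2)
  proof (induction Q rule: finite_induct)
    case empty
    have "(\<lambda>x. indicator (E - {}) x * \<phi> x) = \<phi>" if "\<phi> \<in> M" for \<phi>
      using complementedD(1)[OF M that] by (auto simp: l2_space_def indicator_def fun_eq_iff)
    then have "(\<lambda>\<phi> x. indicator (E - {}) x * \<phi> x) ` M = M"
      by (simp cong: image_cong)
    then show ?case
      using M by simp
  next
    case (insert q Q)
    then have "complemented E ((\<lambda>\<phi>. \<phi>(q := 0)) ` (\<lambda>\<phi> x. indicator (E - Q) x * \<phi> x) ` M)"
      by (intro complemented_erasing_at) auto
    also have "(\<lambda>\<phi>. \<phi>(q := 0)) ` (\<lambda>\<phi> x. indicator (E - Q) x * \<phi> x) ` M =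
        (\<lambda>\<phi> x. indicator (E - insert q Q) x * \<phi> x) ` M"
      unfolding image_image by (intro image_cong) (auto simp: indicator_def fun_eq_iff)
    finally show ?case .
  qed
  have "{\<phi>\<in>L. \<forall>q\<in>p ` {1..m}. \<phi> q = 0} = {\<phi>\<in>L. \<forall>i\<in>{1..m}. \<phi> (p i) = 0}"
    by auto
  then have "pinned_subspace E L p m l =
      (\<lambda>\<phi> x. indicator (E - p ` {m+1..l}) x * \<phi> x) ` {\<phi>\<in>L. \<forall>q\<in>p ` {1..m}. \<phi> q = 0}"
    by (auto simp: pinned_subspace_def image_iff)
  moreover have "p ` {1..m} \<subseteq> E" "p ` {m+1..l} \<subseteq> E"
    using p \<open>m \<le> l\<close> by auto
  ultimately show ?thesis
    by (simp only: era van finite_imageI finite_atLeastAtMost)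
qed

lemma pinned_subspace_vanishes:
  assumes "f \<in> pinned_subspace E L p m l" "i \<in> {1..l}"
  shows "f (p i) = 0"
  using assms by (cases "i \<le> m") (auto simp: pinned_subspace_def)

section \<open>Completeness and tail estimates\<close>

text \<open>
  Completeness of \<open>L\<^sub>1\<close> for a real parameter tending to infinity: the limit is taken almost
  everywhere along a subsequence of integer steps, and Fatou's lemma transfers the Cauchy bound
  to it.
\<close>

lemma L1_Cauchy_at_top_convergent:
  fixes f :: "real \<Rightarrow> 'a \<Rightarrow> real"
  assumes int: "\<And>R. R \<ge> R0 \<Longrightarrow> integrable M (f R)"
    and cauchy: "\<And>e. e > 0 \<Longrightarrow> \<exists>N\<ge>R0. \<forall>R\<ge>N. \<forall>T\<ge>R. (\<integral>x. \<bar>f T x - f R x\<bar> \<partial>M) \<le> e"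
  shows "\<exists>\<psi>. integrable M \<psi> \<and> ((\<lambda>R. \<integral>x. \<bar>f R x - \<psi> x\<bar> \<partial>M) \<longlongrightarrow> 0) at_top"
proof -
  have cauchy2: "\<exists>N\<ge>R0. \<forall>R\<ge>N. \<forall>T\<ge>N. (\<integral>x. \<bar>f R x - f T x\<bar> \<partial>M) \<le> e" if e: "e > 0" for e
  proof -
    obtain N where N: "N \<ge> R0" "\<And>R T. R \<ge> N \<Longrightarrow> T \<ge> R \<Longrightarrow> (\<integral>x. \<bar>f T x - f R x\<bar> \<partial>M) \<le> e"
      using cauchy[OF e] by blast
    have "(\<integral>x. \<bar>f R x - f T x\<bar> \<partial>M) \<le> e" if "R \<ge> N" "T \<ge> N" for R T
      using N(2)[of R T] N(2)[of T R] that by (cases "R \<le> T") (auto simp: abs_minus_commute)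
    then show ?thesis
      using N(1) by blast
  qed
  define s where "s n = f (R0 + real n)" for n
  have s_int: "integrable M (s n)" for n
    unfolding s_def by (rule int) simp
  have "\<exists>N. \<forall>i\<ge>N. \<forall>j\<ge>N. (\<integral>x. norm (s i x - s j x) \<partial>M) < e" if e: "e > 0" for e
  proof -
    obtain N where N: "\<And>R T. R \<ge> N \<Longrightarrow> T \<ge> N \<Longrightarrow> (\<integral>x. \<bar>f R x - f T x\<bar> \<partial>M) \<le> e / 2"
      using cauchy2[of "e / 2"] e by auto
    obtain n :: nat where n: "N - R0 \<le> real n"
      using real_arch_simple by blast
    have "(\<integral>x. norm (s i x - s j x) \<partial>M) < e" if "i \<ge> n" "j \<ge> n" for i j
    proof -
      have "(\<integral>x. norm (s i x - s j x) \<partial>M) \<le> e / 2"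
        unfolding s_def real_norm_def using n that by (intro N) linarith+
      then show ?thesis using e by simp
    qed
    then show ?thesis by blast
  qed
  from cauchy_L1_AE_cauchy_subseq[OF s_int this] obtain r
    where r: "strict_mono r" "AE x in M. Cauchy (\<lambda>i. s (r i) x)" .
  define \<psi> where "\<psi> x = lim (\<lambda>i. s (r i) x)" for x
  have [measurable]: "s n \<in> borel_measurable M" for n
    using s_int by auto
  have \<psi>_meas [measurable]: "\<psi> \<in> borel_measurable M"
    unfolding \<psi>_def[abs_def] by measurable
  have lim: "AE x in M. (\<lambda>i. s (r i) x) \<longlonglongrightarrow> \<psi> x"
    using r(2) by eventually_elim (simp add: \<psi>_def Cauchy_convergent_iff convergent_LIMSEQ_iff)
  have close: "\<exists>N\<ge>R0. \<forall>R\<ge>N. integrable M (\<lambda>x. f R x - \<psi> x) \<and> (\<integral>x. \<bar>f R x - \<psi> x\<bar> \<partial>M) \<le> e"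
    if e: "e > 0" for e
  proof -
    obtain N where N: "N \<ge> R0" "\<And>R T. R \<ge> N \<Longrightarrow> T \<ge> N \<Longrightarrow> (\<integral>x. \<bar>f R x - f T x\<bar> \<partial>M) \<le> e"
      using cauchy2[OF e] by blast
    have "integrable M (\<lambda>x. f R x - \<psi> x) \<and> (\<integral>x. \<bar>f R x - \<psi> x\<bar> \<partial>M) \<le> e" if R: "R \<ge> N" for R
    proof -
      have fR: "integrable M (f R)"
        using R N(1) by (intro int) simp
      then have [measurable]: "f R \<in> borel_measurable M"
        by auto
      obtain n :: nat where n: "N - R0 \<le> real n"
        using real_arch_simple by blast
      have "(\<integral>\<^sup>+x. ennreal \<bar>f R x - \<psi> x\<bar> \<partial>M) =
          (\<integral>\<^sup>+x. liminf (\<lambda>i. ennreal \<bar>f R x - s (r i) x\<bar>) \<partial>M)"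
      proof (rule nn_integral_cong_AE)
        show "AE x in M. ennreal \<bar>f R x - \<psi> x\<bar> = liminf (\<lambda>i. ennreal \<bar>f R x - s (r i) x\<bar>)"
          using lim
        proof eventually_elim
          fix x assume "(\<lambda>i. s (r i) x) \<longlonglongrightarrow> \<psi> x"
          then have "(\<lambda>i. ennreal \<bar>f R x - s (r i) x\<bar>) \<longlonglongrightarrow> ennreal \<bar>f R x - \<psi> x\<bar>"
            by (intro tendsto_intros)
          then show "ennreal \<bar>f R x - \<psi> x\<bar> = liminf (\<lambda>i. ennreal \<bar>f R x - s (r i) x\<bar>)"
            using lim_imp_Liminf[OF sequentially_bot] by metis
        qed
      qed
      also have "\<dots> \<le> liminf (\<lambda>i. \<integral>\<^sup>+x. ennreal \<bar>f R x - s (r i) x\<bar> \<partial>M)"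
        by (intro nn_integral_liminf) measurable
      also have "\<dots> \<le> liminf (\<lambda>i. ennreal e)"
      proof (rule Liminf_mono, rule eventually_sequentiallyI[of n])
        fix i assume "n \<le> i"
        then have "n \<le> r i"
          using seq_suble[OF r(1), of i] by simp
        then have "(\<integral>x. \<bar>f R x - s (r i) x\<bar> \<partial>M) \<le> e"
          unfolding s_def using n R by (intro N) linarith+
        moreover have "(\<integral>\<^sup>+x. ennreal \<bar>f R x - s (r i) x\<bar> \<partial>M) = ennreal (\<integral>x. \<bar>f R x - s (r i) x\<bar> \<partial>M)"
          using fR s_int by (intro nn_integral_eq_integral) auto
        ultimately show "(\<integral>\<^sup>+x. ennreal \<bar>f R x - s (r i) x\<bar> \<partial>M) \<le> ennreal e"
          by (simp add: ennreal_leI)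
      qed
      finally have le: "(\<integral>\<^sup>+x. ennreal \<bar>f R x - \<psi> x\<bar> \<partial>M) \<le> ennreal e"
        by (simp add: Liminf_const)
      then have I: "integrable M (\<lambda>x. f R x - \<psi> x)"
        by (intro integrableI_bounded) (auto intro: le_less_trans)
      then have "ennreal (\<integral>x. \<bar>f R x - \<psi> x\<bar> \<partial>M) \<le> ennreal e"
        using le by (subst nn_integral_eq_integral[symmetric]) auto
      then show ?thesis
        using I e by (simp add: ennreal_le_iff)
    qed
    then show ?thesis
      using N(1) by blast
  qed
  obtain N where N: "N \<ge> R0" "integrable M (\<lambda>x. f N x - \<psi> x)"
    using close[of 1] by auto
  have "integrable M (\<lambda>x. f N x - (f N x - \<psi> x))"
    by (rule Bochner_Integration.integrable_diff[OF int[OF N(1)] N(2)])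
  then have "integrable M \<psi>"
    by simp
  moreover have "((\<lambda>R. \<integral>x. \<bar>f R x - \<psi> x\<bar> \<partial>M) \<longlongrightarrow> 0) at_top"
  proof (rule tendstoI)
    fix e :: real assume "e > 0"
    then obtain N where "\<And>R. R \<ge> N \<Longrightarrow> (\<integral>x. \<bar>f R x - \<psi> x\<bar> \<partial>M) \<le> e / 2"
      using close[of "e / 2"] by auto
    then show "\<forall>\<^sub>F R in at_top. dist (\<integral>x. \<bar>f R x - \<psi> x\<bar> \<partial>M) 0 < e"
      using \<open>e > 0\<close> unfolding eventually_at_top_linorder
      by (intro exI[of _ N]) (force simp: dist_real_def)
  qed
  ultimately show ?thesis by blast
qed

definition near_one_at_infinity :: "(real \<Rightarrow> real) \<Rightarrow> bool" where
  "near_one_at_infinity f \<longleftrightarrow> (\<exists>C\<ge>0. \<exists>R0. \<forall>x. R0 \<le> \<bar>x\<bar> \<longrightarrow> \<bar>f x - 1\<bar> \<le> C / \<bar>x\<bar>)"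

lemma near_one_at_infinity_mult:
  assumes "near_one_at_infinity f" "near_one_at_infinity g"
  shows "near_one_at_infinity (\<lambda>x. f x * g x)"
proof -
  obtain C R where C: "C \<ge> 0" "\<And>x. R \<le> \<bar>x\<bar> \<Longrightarrow> \<bar>f x - 1\<bar> \<le> C / \<bar>x\<bar>"
    using assms(1) by (auto simp: near_one_at_infinity_def)
  obtain D T where D: "D \<ge> 0" "\<And>x. T \<le> \<bar>x\<bar> \<Longrightarrow> \<bar>g x - 1\<bar> \<le> D / \<bar>x\<bar>"
    using assms(2) by (auto simp: near_one_at_infinity_def)
  have "\<bar>f x * g x - 1\<bar> \<le> (C * D + C + D) / \<bar>x\<bar>" if x: "max 1 (max R T) \<le> \<bar>x\<bar>" for x
  proof -
    have "\<bar>a * b + a + b\<bar> \<le> \<bar>a\<bar> * \<bar>b\<bar> + \<bar>a\<bar> + \<bar>b\<bar>" for a b :: real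
      unfolding abs_mult[symmetric] by linarith
    moreover have "f x * g x - 1 = (f x - 1) * (g x - 1) + (f x - 1) + (g x - 1)"
      by (simp add: algebra_simps)
    ultimately have "\<bar>f x * g x - 1\<bar> \<le> \<bar>f x - 1\<bar> * \<bar>g x - 1\<bar> + \<bar>f x - 1\<bar> + \<bar>g x - 1\<bar>"
      by (simp only:)
    also have "\<dots> \<le> C / \<bar>x\<bar> * D + C / \<bar>x\<bar> + D / \<bar>x\<bar>"
    proof (intro add_mono mult_mono)
      have "D / \<bar>x\<bar> \<le> D / 1"
        using x D(1) by (intro divide_left_mono) auto
      then show "\<bar>g x - 1\<bar> \<le> D"
        using D(2)[of x] x by simp
    qed (use x C D in auto)
    also have "\<dots> = (C * D + C + D) / \<bar>x\<bar>"
      by (simp add: add_divide_distrib)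
    finally show ?thesis .
  qed
  then show ?thesis
    unfolding near_one_at_infinity_def using C(1) D(1)
    by (intro exI[of _ "C * D + C + D"] conjI exI[of _ "max 1 (max R T)"]) auto
qed

lemma near_one_at_infinity_prod:
  assumes "finite I" "\<And>i. i \<in> I \<Longrightarrow> near_one_at_infinity (f i)"
  shows "near_one_at_infinity (\<lambda>x. \<Prod>i\<in>I. f i x)"
  using assms
proof (induction I rule: finite_induct)
  case empty
  show ?case
    unfolding near_one_at_infinity_def by (intro exI[of _ 0]) auto
next
  case (insert i I)
  then show ?case
    by (simp add: near_one_at_infinity_mult)
qed

lemma near_one_at_infinity_moebius: "near_one_at_infinity (\<lambda>x. (x - a) / (x - b))"
proof -
  have "\<bar>(x - a) / (x - b) - 1\<bar> \<le> 2 * \<bar>b - a\<bar> / \<bar>x\<bar>" if x: "2 * \<bar>b\<bar> + 1 \<le> \<bar>x\<bar>" for x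
  proof -
    have pos: "\<bar>x\<bar> / 2 \<le> \<bar>x - b\<bar>" "0 < \<bar>x\<bar>" "x \<noteq> b"
      using x by linarith+
    then have "(x - a) / (x - b) - 1 = (b - a) / (x - b)"
      by (simp add: field_simps)
    then have "\<bar>(x - a) / (x - b) - 1\<bar> = \<bar>b - a\<bar> / \<bar>x - b\<bar>"
      by simp
    also have "\<dots> \<le> \<bar>b - a\<bar> / (\<bar>x\<bar> / 2)"
      using pos by (intro divide_left_mono mult_pos_pos) auto
    finally show ?thesis by (simp add: mult.commute)
  qed
  then show ?thesis
    unfolding near_one_at_infinity_def
    by (intro exI[of _ "2 * \<bar>b - a\<bar>"] conjI exI[of _ "2 * \<bar>b\<bar> + 1"]) auto
qed

lemma summable_on_tail_small:
  fixes w :: "real \<Rightarrow> real"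
  assumes "w summable_on E" "e > 0"
  shows "\<exists>R. \<forall>F. finite F \<and> F \<subseteq> E \<and> (\<forall>x\<in>F. R < \<bar>x\<bar>) \<longrightarrow> sum w F < e"
proof -
  from assms(1) obtain s where "(sum w \<longlongrightarrow> s) (finite_subsets_at_top E)"
    by (auto simp: summable_on_def has_sum_def)
  then have "\<forall>\<^sub>F A in finite_subsets_at_top E. dist (sum w A) s < e / 2"
    using assms(2) by (intro tendstoD) auto
  then obtain A where A: "finite A" "A \<subseteq> E"
      "\<And>B. finite B \<Longrightarrow> A \<subseteq> B \<Longrightarrow> B \<subseteq> E \<Longrightarrow> dist (sum w B) s < e / 2"
    by (auto simp: eventually_finite_subsets_at_top)
  obtain R where R: "\<And>x. x \<in> A \<Longrightarrow> \<bar>x\<bar> \<le> R"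
    using finite_imp_bounded[OF A(1)] by (auto simp: bounded_iff)
  have "sum w F < e" if F: "finite F" "F \<subseteq> E" "\<And>x. x \<in> F \<Longrightarrow> R < \<bar>x\<bar>" for F
  proof -
    have "A \<inter> F = {}"
      using R F(3) by fastforce
    then have "sum w F = sum w (A \<union> F) - sum w A"
      using A F by (simp add: sum.union_disjoint)
    moreover have "dist (sum w (A \<union> F)) s < e / 2" "dist (sum w A) s < e / 2"
      using A F by auto
    ultimately show ?thesis
      unfolding dist_real_def by linarith
  qed
  then show ?thesis
    by (intro exI[of _ R]) simp
qed

text \<open>
  As \<open>(f x - 1)\<^sup>2\<close> is of order \<open>1 / x\<^sup>2\<close>, which is comparable to \<open>1 / (1 + x\<^sup>2)\<close>, the
  assumption on \<open>E\<close> makes the sum of these squares converge.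
\<close>

lemma near_one_at_infinity_square_tail:
  assumes E: "(\<lambda>n. 1 / (1 + n\<^sup>2)) summable_on E" and f: "near_one_at_infinity f" and e: "e > 0"
  shows "\<exists>R. (\<forall>x. R < \<bar>x\<bar> \<longrightarrow> \<bar>f x - 1\<bar> \<le> 1/2) \<and>
    (\<forall>F. finite F \<and> F \<subseteq> E \<and> (\<forall>x\<in>F. R < \<bar>x\<bar>) \<longrightarrow> (\<Sum>x\<in>F. (f x - 1)\<^sup>2) \<le> e)"
proof -
  obtain C R0 where C: "C \<ge> 0" "\<And>x. R0 \<le> \<bar>x\<bar> \<Longrightarrow> \<bar>f x - 1\<bar> \<le> C / \<bar>x\<bar>"
    using f by (auto simp: near_one_at_infinity_def)
  have "e / (2 * C\<^sup>2 + 1) > 0"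
    using e by (simp add: add_nonneg_pos)
  then obtain R1 where R1: "\<And>F. finite F \<Longrightarrow> F \<subseteq> E \<Longrightarrow> (\<And>x. x \<in> F \<Longrightarrow> R1 < \<bar>x\<bar>)
      \<Longrightarrow> (\<Sum>n\<in>F. 1 / (1 + n\<^sup>2)) < e / (2 * C\<^sup>2 + 1)"
    using summable_on_tail_small[OF E, of "e / (2 * C\<^sup>2 + 1)"] by meson
  define R where "R = Max {1, 2 * C, R0, R1}"
  have R: "1 \<le> R" "2 * C \<le> R" "R0 \<le> R" "R1 \<le> R"
    by (simp_all add: R_def)
  have half: "\<bar>f x - 1\<bar> \<le> 1/2" if "R < \<bar>x\<bar>" for x
  proof -
    have "C / \<bar>x\<bar> \<le> 1/2"
      using that R by (simp add: field_simps)
    then show ?thesis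
      using C(2)[of x] that R by linarith
  qed
  have sq: "(f x - 1)\<^sup>2 \<le> (2 * C\<^sup>2 + 1) * (1 / (1 + x\<^sup>2))" if x: "R < \<bar>x\<bar>" for x
  proof -
    have "1 \<le> \<bar>x\<bar>"
      using x R by simp
    then have x2: "1 \<le> x\<^sup>2"
      using power_mono[of 1 "\<bar>x\<bar>" 2] by simp
    have "(f x - 1)\<^sup>2 \<le> (C / \<bar>x\<bar>)\<^sup>2"
      using C(2)[of x] x R power_mono[of "\<bar>f x - 1\<bar>" "C / \<bar>x\<bar>" 2] by simp
    also have "\<dots> = C\<^sup>2 / x\<^sup>2"
      by (simp add: power_divide)
    also have "\<dots> \<le> (2 * C\<^sup>2) / (1 + x\<^sup>2)"
    proof -
      have "C\<^sup>2 * (1 + x\<^sup>2) \<le> C\<^sup>2 * (2 * x\<^sup>2)"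
        using x2 by (intro mult_left_mono) auto
      then show ?thesis
        using x2 by (simp add: divide_simps mult_ac)
    qed
    also have "\<dots> \<le> (2 * C\<^sup>2 + 1) * (1 / (1 + x\<^sup>2))"
      using x2 by (simp add: divide_right_mono)
    finally show ?thesis .
  qed
  have "(\<Sum>x\<in>F. (f x - 1)\<^sup>2) \<le> e" if F: "finite F" "F \<subseteq> E" "\<And>x. x \<in> F \<Longrightarrow> R < \<bar>x\<bar>" for F
  proof -
    have pos: "2 * C\<^sup>2 + 1 > 0"
      by (simp add: add_nonneg_pos)
    have "(\<Sum>x\<in>F. (f x - 1)\<^sup>2) \<le> (\<Sum>x\<in>F. (2 * C\<^sup>2 + 1) * (1 / (1 + x\<^sup>2)))"
      by (intro sum_mono sq F(3))
    also have "\<dots> = (2 * C\<^sup>2 + 1) * (\<Sum>x\<in>F. 1 / (1 + x\<^sup>2))"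
      by (simp only: sum_distrib_left)
    also have "\<dots> \<le> (2 * C\<^sup>2 + 1) * (e / (2 * C\<^sup>2 + 1))"
      using pos F R(4) by (intro mult_left_mono less_imp_le[OF R1]) (auto intro: le_less_trans)
    finally show ?thesis
      using pos by simp
  qed
  with half show ?thesis
    by (intro exI[of _ R]) simp
qed

section \<open>The limit of the normalized functionals\<close>

lemma (in hermitian_determinantal) normalized_mult_func_L1_limit:
  assumes D: "D \<subseteq> E" and fin: "\<And>R. finite {x\<in>D. \<bar>x\<bar> \<le> R}"
    and sum: "(\<lambda>n. 1 / (1 + n\<^sup>2)) summable_on E"
    and pos: "\<And>x. x \<in> D \<Longrightarrow> h x > 0" and near: "near_one_at_infinity h"
  defines "F R \<equiv> {x\<in>D. \<bar>x\<bar> \<le> R}"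
  shows "\<exists>\<psi>. integrable P \<psi> \<and>
    ((\<lambda>R. \<integral>X. \<bar>mult_func h (F R) X / norm_const h (F R) - \<psi> X\<bar> \<partial>P) \<longlongrightarrow> 0) at_top"
proof (rule L1_Cauchy_at_top_convergent[where ?R0.0 = 0])
  have F: "finite (F R)" "F R \<subseteq> E" for R
    using D fin by (auto simp: F_def)
  show "integrable P (\<lambda>X. mult_func h (F R) X / norm_const h (F R))" for R
    using integrable_mult_func[OF F] by simp
  fix e :: real assume e: "e > 0"
  \<comment> \<open>Chosen such that \<open>exp (8 * \<eta>) - 1 = e\<^sup>2\<close>.\<close>
  define \<eta> where "\<eta> = ln (1 + e\<^sup>2) / 8"
  have \<eta>: "\<eta> > 0"
    using e ln_gt_zero[of "1 + e\<^sup>2"] by (simp add: \<eta>_def)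
  from near_one_at_infinity_square_tail[OF sum near \<eta>] obtain N
    where half: "\<forall>x. N < \<bar>x\<bar> \<longrightarrow> \<bar>h x - 1\<bar> \<le> 1/2"
      and tail: "\<forall>A. finite A \<and> A \<subseteq> E \<and> (\<forall>x\<in>A. N < \<bar>x\<bar>) \<longrightarrow> (\<Sum>x\<in>A. (h x - 1)\<^sup>2) \<le> \<eta>"
    by (elim exE conjE)
  have "(\<integral>X. \<bar>mult_func h (F T) X / norm_const h (F T) - mult_func h (F R) X / norm_const h (F R)\<bar> \<partial>P) \<le> e"
    if RT: "max 0 N \<le> R" "R \<le> T" for R T
  proof -
    let ?A = "F T - F R"
    have T: "F T = F R \<union> ?A"
      using RT by (auto simp: F_def)
    have out: "\<forall>x\<in>?A. N < \<bar>x\<bar>"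
      using RT by (auto simp: F_def)
    have "(\<Sum>x\<in>?A. (h x - 1)\<^sup>2) \<le> \<eta>"
      using F[of T] out by (intro tail[rule_format]) auto
    then have "exp (8 * (\<Sum>x\<in>?A. (h x - 1)\<^sup>2)) \<le> exp (8 * \<eta>)"
      by simp
    also have "\<dots> = 1 + e\<^sup>2"
      by (simp add: \<eta>_def add_pos_nonneg)
    finally have "exp (8 * (\<Sum>x\<in>?A. (h x - 1)\<^sup>2)) - 1 \<le> e\<^sup>2"
      by simp
    moreover have "finite ?A" "?A \<subseteq> E - F R"
      using F[of T] by auto
    moreover have "h x > 0" if "x \<in> F R" for x
      using that pos by (simp add: F_def)
    moreover have "\<bar>h x - 1\<bar> \<le> 1/2" if "x \<in> ?A" for x
      using that out half by blast
    ultimately show ?thesis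
      using normalized_mult_func_L1_increment[of ?A "F R" h e] F[of R] e T by simp
  qed
  then show "\<exists>N\<ge>0. \<forall>R\<ge>N. \<forall>T\<ge>R.
      (\<integral>X. \<bar>mult_func h (F T) X / norm_const h (F T) - mult_func h (F R) X / norm_const h (F R)\<bar> \<partial>P) \<le> e"
    by (intro exI[of _ "max 0 N"]) auto
qed

lemma finite_Int_abs_le_of_no_islimpt:
  fixes E :: "real set"
  assumes "\<forall>x. \<not> x islimpt E"
  shows "finite {x\<in>E. \<bar>x\<bar> \<le> R}"
proof (rule ccontr)
  assume inf: "infinite {x\<in>E. \<bar>x\<bar> \<le> R}"
  have "{x\<in>E. \<bar>x\<bar> \<le> R} \<subseteq> {-R..R}"
    by auto
  with inf obtain x where "x islimpt {x\<in>E. \<bar>x\<bar> \<le> R}"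
    using Heine_Borel_imp_Bolzano_Weierstrass[OF compact_Icc] by blast
  then have "x islimpt E"
    by (rule islimpt_subset) auto
  then show False
    using assms by blast
qed

theorem proposition1p5:
  fixes E :: "real set"
    and K :: "real \<Rightarrow> real \<Rightarrow> complex"
    and L :: "(real \<Rightarrow> complex) set"
    and p :: "nat \<Rightarrow> real"
    and l m :: nat
    and \<sigma> :: "real \<Rightarrow> real"
    and P :: "real set measure"
  assumes "countable E"
    and "\<forall>x. \<not> x islimpt E"
    and "(\<lambda>n. 1 / (1 + n\<^sup>2)) summable_on E"
    and "orthogonal_projection_kernel E K"
    and "L = kernel_range E K"
    and "p ` {1..l} \<subseteq> E"
    and "inj_on p {1..l}"
    and "\<not> (\<exists>f\<in>L. f \<noteq> (\<lambda>x. 0) \<and> (\<forall>x. x \<notin> p ` {1..l} \<longrightarrow> f x = 0))"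
    and "m \<le> l"
    and "\<sigma> permutes p ` {1..l}"
    and "determinantal_measure E (proj_kernel E (pinned_subspace E L p m l)) P"
  shows "(\<forall>R>0. integrable P (Psi E P p l m \<sigma> R)) \<and>
    (\<exists>\<Psi>. integrable P \<Psi> \<and>
      ((\<lambda>R. \<integral>X. \<bar>Psi E P p l m \<sigma> R X - \<Psi> X\<bar> \<partial>P) \<longlongrightarrow> 0) at_top)"
proof -
  define S where "S = p ` {1..l}"
  define K' where "K' = proj_kernel E (pinned_subspace E L p m l)"
  have compl: "complemented E (pinned_subspace E L p m l)"
    using assms by (intro complemented_pinned_subspace) (auto intro: complemented_kernel_range)
  interpret hermitian_determinantal E K' P
  proof
    show "determinantal_measure E K' P"
      using assms(11) by (simp only: K'_def)
    show "K' y x = cnj (K' x y)" if "x \<in> E" "y \<in> E" for x y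
      unfolding K'_def by (rule proj_kernel_hermitian[OF compl that])
  qed
  have SE: "S \<subseteq> E"
    using assms by (simp add: S_def)
  \<comment> \<open>All functions in the pinned subspace vanish on \<open>S\<close>, so almost every configuration avoids
    the points where \<open>g\<close> may be 0 or a quotient with denominator 0.\<close>
  have avoid: "AE X in P. X \<inter> S = {}"
  proof -
    have "AE X in P. q \<notin> X" if "q \<in> S" for q
    proof (rule AE_unoccupied)
      show "q \<in> E"
        using that SE by auto
      then show "K' q q = 0"
        using that pinned_subspace_vanishes unfolding K'_def S_def
        by (intro proj_kernel_vanishes[OF compl]) auto
    qed
    then have "AE X in P. \<forall>q\<in>S. q \<notin> X"
      by (intro AE_finite_allI) (simp_all add: S_def)
    then show ?thesis
      by eventually_elim auto
  qed
  define g where "g x = (\<Prod>i=1..m. ((x - \<sigma> (p i)) / (x - p i))\<^sup>2)" for x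
  define F where "F R = {x\<in>E - S. \<bar>x\<bar> \<le> R}" for R
  define f where "f R X = mult_func g (F R) X / norm_const g (F R)" for R X
  have finE: "finite {x\<in>E. \<bar>x\<bar> \<le> R}" for R
    using assms(2) by (rule finite_Int_abs_le_of_no_islimpt)
  have finF: "finite (F R)" and FE: "F R \<subseteq> E" for R
    by (auto simp: F_def intro: finite_subset[OF _ finE])
  have g_pos: "g x > 0" if "x \<notin> S" for x
    unfolding g_def
  proof (rule prod_pos)
    fix i assume "i \<in> {1..m}"
    then have "p i \<in> S"
      using \<open>m \<le> l\<close> by (auto simp: S_def)
    moreover from this have "\<sigma> (p i) \<in> S"
      using permutes_in_image[OF assms(10)] by (simp add: S_def)
    ultimately show "((x - \<sigma> (p i)) / (x - p i))\<^sup>2 > 0"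
      using that by auto
  qed
  have g_near: "near_one_at_infinity g"
    unfolding g_def power2_eq_square
    by (intro near_one_at_infinity_prod near_one_at_infinity_mult near_one_at_infinity_moebius) simp
  have Z: "norm_const g (F R) > 0" for R
    by (intro norm_const_pos finF FE g_pos) (simp add: F_def)
  have un_AE: "AE X in P. Psi_unnormalized E p l m \<sigma> R X = mult_func g (F R) X" for R
    using avoid AE_space
  proof eventually_elim
    case (elim X)
    then have "{x. x \<in> X \<and> \<bar>x\<bar> \<le> R} = X \<inter> F R"
      by (auto simp: F_def space_P)
    then show ?case
      unfolding Psi_unnormalized_def mult_func_def
      by (auto simp: g_def F_def S_def indicator_def intro!: prod.cong)
  qed
  \<comment> \<open>On configurations that meet \<open>S\<close> as well, the functional is a product over a finite
    subset of \<open>E\<close>, with weight 0 on \<open>S\<close>.\<close>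
  have un_meas: "Psi_unnormalized E p l m \<sigma> R \<in> borel_measurable P" for R
  proof -
    let ?k = "\<lambda>x. g x * indicator (E - S) x"
    have "Psi_unnormalized E p l m \<sigma> R X = mult_func ?k {x\<in>E. \<bar>x\<bar> \<le> R} X" if "X \<in> space P" for X
    proof -
      have "{x. x \<in> X \<and> \<bar>x\<bar> \<le> R} = X \<inter> {x\<in>E. \<bar>x\<bar> \<le> R}"
        using that by (auto simp: space_P)
      then show ?thesis
        by (simp add: Psi_unnormalized_def mult_func_def g_def S_def)
    qed
    then show ?thesis
      using mult_func_measurable[OF finE, of R ?k] by (subst measurable_cong) auto
  qed
  have const: "Psi_const E P p l m \<sigma> R = 1 / norm_const g (F R)" for R
  proof -
    have scale: "(\<integral>X. c * Psi_unnormalized E p l m \<sigma> R X \<partial>P) = c * norm_const g (F R)" for c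
    proof -
      have "(\<integral>X. Psi_unnormalized E p l m \<sigma> R X \<partial>P) = norm_const g (F R)"
        unfolding norm_const_def
        by (intro integral_cong_AE un_meas un_AE mult_func_measurable finF FE)
      then show ?thesis by simp
    qed
    then show ?thesis
      unfolding Psi_const_def scale
      using Z[of R] by (intro the_equality) (auto simp: field_simps)
  qed
  have Psi_AE: "AE X in P. Psi E P p l m \<sigma> R X = f R X" for R
    using un_AE[of R] by eventually_elim (simp add: Psi_def const f_def)
  have Psi_meas: "Psi E P p l m \<sigma> R \<in> borel_measurable P" for R
    using un_meas[of R] unfolding Psi_def[abs_def] by simp
  have f_int: "integrable P (f R)" for R
    using integrable_mult_func[OF finF FE] unfolding f_def by simp
  then have f_meas: "f R \<in> borel_measurable P" for R
    by auto
  have Psi_int: "integrable P (Psi E P p l m \<sigma> R)" for R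
    using integrable_cong_AE[OF Psi_meas f_meas Psi_AE] f_int by simp
  obtain \<psi> where \<psi>: "integrable P \<psi>" "((\<lambda>R. \<integral>X. \<bar>f R X - \<psi> X\<bar> \<partial>P) \<longlongrightarrow> 0) at_top"
  proof -
    have "finite {x\<in>E - S. \<bar>x\<bar> \<le> R}" for R
      using finF by (simp add: F_def)
    then show ?thesis
      using normalized_mult_func_L1_limit[of "E - S" g] assms(3) g_pos g_near that
      unfolding f_def F_def by auto
  qed
  have "(\<integral>X. \<bar>Psi E P p l m \<sigma> R X - \<psi> X\<bar> \<partial>P) = (\<integral>X. \<bar>f R X - \<psi> X\<bar> \<partial>P)" for R
    using Psi_AE[of R] Psi_meas[of R] f_meas[of R] \<psi>(1) by (intro integral_cong_AE) auto
  with \<psi> Psi_int show ?thesis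
    by auto
qed

end
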